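(* Let $R$ be a semisimple ring with an injective endomorphism $\sigma$ and let $R\subseteq_\sigma A$ be a Jordan extension. Then $A$ is semisimple. In fact, if $R=\prod_{i=1}^{n}M_{n_i}(D_i)$ for some division rings $D_i$, then $A=\prod_{i=1}^{n}M_{n_i}(K_i)$ (up to ring isomorphism) for suitable division rings $K_i$.
   Context: All rings are associative with unity, and ring endomorphisms preserve the unity. Semisimple means semisimple artinian. For a ring $R$ with injective endomorphism $\sigma$, a Jordan extension of $R$, written $R\subseteq_\sigma A$, is an over-ring $A$ of $R$ such that $\sigma$ extends to an automorphism of $A$ (again denoted $\sigma$) and $A=\bigcup_{i=0}^\infty \sigma^{-i}(R)$. $M_m(D)$ is the full $m\times m$ matrix ring over $D$. *)

theory Defs
  imports "HOL-Algebra.Algebra"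
begin

definition left_ideal :: "'a set \<Rightarrow> ('a, 'm) ring_scheme \<Rightarrow> bool" where
  "left_ideal I R \<longleftrightarrow> additive_subgroup I R \<and>
     (\<forall>r \<in> carrier R. \<forall>x \<in> I. r \<otimes>\<^bsub>R\<^esub> x \<in> I)"

definition right_ideal :: "'a set \<Rightarrow> ('a, 'm) ring_scheme \<Rightarrow> bool" where
  "right_ideal I R \<longleftrightarrow> additive_subgroup I R \<and>
     (\<forall>r \<in> carrier R. \<forall>x \<in> I. x \<otimes>\<^bsub>R\<^esub> r \<in> I)"

definition artinian :: "('a, 'm) ring_scheme \<Rightarrow> bool" where
  "artinian R \<longleftrightarrow>
     (\<forall>I :: nat \<Rightarrow> 'a set.
        (\<forall>k. left_ideal (I k) R \<and> I (Suc k) \<subseteq> I k) \<longrightarrow> (\<exists>N. \<forall>k\<ge>N. I k = I N)) \<and>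
     (\<forall>I :: nat \<Rightarrow> 'a set.
        (\<forall>k. right_ideal (I k) R \<and> I (Suc k) \<subseteq> I k) \<longrightarrow> (\<exists>N. \<forall>k\<ge>N. I k = I N))"

definition maximal_left_ideal :: "'a set \<Rightarrow> ('a, 'm) ring_scheme \<Rightarrow> bool" where
  "maximal_left_ideal M R \<longleftrightarrow> left_ideal M R \<and> M \<noteq> carrier R \<and>
     (\<forall>I. left_ideal I R \<and> M \<subseteq> I \<longrightarrow> I = M \<or> I = carrier R)"

text \<open>The intersection is taken inside the ring, so that the radical of the zero ring, which has
  no maximal left ideal, is the whole ring.\<close>
definition jacobson_radical :: "('a, 'm) ring_scheme \<Rightarrow> 'a set" where
  "jacobson_radical R = {x \<in> carrier R. \<forall>M. maximal_left_ideal M R \<longrightarrow> x \<in> M}"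

text \<open>Semisimple means semisimple artinian; in particular the zero ring is semisimple,
  being the empty product of matrix rings.\<close>
definition semisimple_ring :: "('a, 'm) ring_scheme \<Rightarrow> bool" where
  "semisimple_ring R \<longleftrightarrow> ring R \<and> jacobson_radical R = {\<zero>\<^bsub>R\<^esub>} \<and> artinian R"

text \<open>Membership of the identity in \<^const>\<open>ring_hom\<close> says that the carrier of \<open>R\<close> is a subset of
  the carrier of \<open>A\<close> and that both rings have the same unity and, on \<open>R\<close>, the same operations.
  The set \<open>{a \<in> carrier A. (\<tau> ^^ i) a \<in> carrier R}\<close> is the preimage of \<open>R\<close> under the
  \<open>i\<close>-th power of the automorphism \<open>\<tau>\<close> of \<open>A\<close>.\<close>
definition jordan_extension ::
  "('a, 'm) ring_scheme \<Rightarrow> ('a \<Rightarrow> 'a) \<Rightarrow> ('a, 'n) ring_scheme \<Rightarrow> bool" where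
  "jordan_extension R \<sigma> A \<longleftrightarrow> ring A \<and> (\<lambda>x. x) \<in> ring_hom R A \<and>
     (\<exists>\<tau> \<in> ring_iso A A. (\<forall>x \<in> carrier R. \<tau> x = \<sigma> x) \<and>
        carrier A = (\<Union>i :: nat. {a \<in> carrier A. (\<tau> ^^ i) a \<in> carrier R}))"

text \<open>Nontriviality is included: zero is not a unit, whereas one is.\<close>
locale skew_field = ring D for D (structure) +
  assumes skew_field_Units: "Units D = carrier D - {\<zero>}"

definition matrix_ring :: "nat \<Rightarrow> ('a, 'm) ring_scheme \<Rightarrow> (nat \<times> nat \<Rightarrow> 'a) ring" where
  "matrix_ring m D =
    \<lparr>carrier = ({..<m} \<times> {..<m}) \<rightarrow>\<^sub>E carrier D,
     monoid.mult = (\<lambda>a b. restrict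
        (\<lambda>(i, j). \<Oplus>\<^bsub>D\<^esub>k \<in> {..<m}. a (i, k) \<otimes>\<^bsub>D\<^esub> b (k, j)) ({..<m} \<times> {..<m})),
     monoid.one = restrict (\<lambda>(i, j). if i = j then \<one>\<^bsub>D\<^esub> else \<zero>\<^bsub>D\<^esub>) ({..<m} \<times> {..<m}),
     ring.zero = restrict (\<lambda>(i, j). \<zero>\<^bsub>D\<^esub>) ({..<m} \<times> {..<m}),
     ring.add = (\<lambda>a b. restrict
        (\<lambda>(i, j). a (i, j) \<oplus>\<^bsub>D\<^esub> b (i, j)) ({..<m} \<times> {..<m}))\<rparr>"

definition product_ring :: "'i set \<Rightarrow> ('i \<Rightarrow> ('a, 'm) ring_scheme) \<Rightarrow> ('i \<Rightarrow> 'a) ring" where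
  "product_ring I S =
    \<lparr>carrier = (\<Pi>\<^sub>E i \<in> I. carrier (S i)),
     monoid.mult = (\<lambda>x y. \<lambda>i \<in> I. x i \<otimes>\<^bsub>S i\<^esub> y i),
     monoid.one = (\<lambda>i \<in> I. \<one>\<^bsub>S i\<^esub>),
     ring.zero = (\<lambda>i \<in> I. \<zero>\<^bsub>S i\<^esub>),
     ring.add = (\<lambda>x y. \<lambda>i \<in> I. x i \<oplus>\<^bsub>S i\<^esub> y i)\<rparr>"

end

theory Submission
  imports Defs
begin

text \<open>Every finite subset of \<open>A\<close> is carried into \<open>R\<close> by a power of the automorphism, so finitary
  properties of \<open>R\<close> pass to \<open>A\<close>. If \<open>R\<close> is semisimple, the zero ideal is a finite intersection of
  maximal left ideals, which bounds the length of chains of left ideals of \<open>R\<close>, hence of \<open>A\<close>; and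
  \<open>R\<close>, hence \<open>A\<close>, is von Neumann regular, which makes the radical vanish and is left-right
  symmetric, so that the right-hand chain condition follows by passing to opposite rings.

  For the decomposition, let \<open>e\<close> be the matrix units of \<open>R\<close>. The images of \<open>e\<close> under a power of the
  automorphism lying in \<open>R\<close> form another system of matrix units of the same shape in \<open>R\<close>. Comparing
  the number of diagonal idempotents with the length of \<open>R\<close> shows that these idempotents are again
  primitive, and counting blocks shows that they are distributed to the blocks of \<open>R\<close> by a
  permutation. Hence \<open>e i 0 0 A e i 0 0\<close> is a division ring and distinct blocks annihilate each
  other in \<open>A\<close>, and the matrix units decompose \<open>A\<close> accordingly.\<close>

subsection \<open>Left ideals of bounded length and von Neumann regularity\<close>

text \<open>Chain conditions and the radical involve infinitely many elements at once, so no single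
  power of the automorphism pulls them into \<open>R\<close>. Each is replaced by something
  finitary. A length bound N is violated by N + 2 left ideals in a strict chain, which N + 1
  witnesses separate; \<open>left_length_le\<close> expresses the bound by a strictly increasing
  rank, so that no composition series need be compared. Vanishing of the radical is replaced by
  solvability of a r a = a, which concerns one element at a time.

  In the decomposition the obstacle is that the automorphism need not fix the matrix units and a
  priori need not respect blocks: the image of a block of \<open>R\<close> is in general no ideal of
  \<open>R\<close>. The power required also varies with the element of \<open>A\<close>. So nothing
  is tracked along the powers; instead any system of matrix units of \<open>R\<close> with the given
  shape is shown to have the same properties as the initial one. That is a counting statement, and
  finite length of \<open>R\<close> and finiteness of the index set enter there.\<close>

definition left_length_le :: "('a, 'm) ring_scheme \<Rightarrow> nat \<Rightarrow> bool" where
  "left_length_le R N \<longleftrightarrow> (\<exists>len :: 'a set \<Rightarrow> nat. \<forall>L. left_ideal L R \<longrightarrow>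
     len L \<le> N \<and> (\<forall>L'. left_ideal L' R \<and> L \<subset> L' \<longrightarrow> len L < len L'))"

text \<open>One half of \<open>artinian\<close>. The other half is the same condition on the
  opposite ring, so each argument is made once.\<close>

definition left_artinian :: "('a, 'm) ring_scheme \<Rightarrow> bool" where
  "left_artinian R \<longleftrightarrow> (\<forall>I :: nat \<Rightarrow> 'a set.
     (\<forall>k. left_ideal (I k) R \<and> I (Suc k) \<subseteq> I k) \<longrightarrow> (\<exists>N. \<forall>k\<ge>N. I k = I N))"

definition von_neumann_regular :: "('a, 'm) ring_scheme \<Rightarrow> bool" where
  "von_neumann_regular R \<longleftrightarrow>
     (\<forall>a \<in> carrier R. \<exists>r \<in> carrier R. a \<otimes>\<^bsub>R\<^esub> r \<otimes>\<^bsub>R\<^esub> a = a)"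

section \<open>Left ideals in elementary terms\<close>

context ring
begin

text \<open>Negatives are multiples by \<open>\<ominus> \<one>\<close>, so closure under them need
  not be listed.\<close>

lemma left_ideal_iff:
  "left_ideal L R \<longleftrightarrow> L \<subseteq> carrier R \<and> \<zero> \<in> L \<and> (\<forall>x\<in>L. \<forall>y\<in>L. x \<oplus> y \<in> L) \<and>
     (\<forall>r\<in>carrier R. \<forall>x\<in>L. r \<otimes> x \<in> L)"
proof
  assume "left_ideal L R"
  then show "L \<subseteq> carrier R \<and> \<zero> \<in> L \<and> (\<forall>x\<in>L. \<forall>y\<in>L. x \<oplus> y \<in> L) \<and>
     (\<forall>r\<in>carrier R. \<forall>x\<in>L. r \<otimes> x \<in> L)"
    unfolding left_ideal_def
    using additive_subgroup.a_subset additive_subgroup.a_closed additive_subgroup.zero_closed by metis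
next
  assume L: "L \<subseteq> carrier R \<and> \<zero> \<in> L \<and> (\<forall>x\<in>L. \<forall>y\<in>L. x \<oplus> y \<in> L) \<and>
     (\<forall>r\<in>carrier R. \<forall>x\<in>L. r \<otimes> x \<in> L)"
  have "\<ominus> x \<in> L" if "x \<in> L" for x
  proof -
    have "\<ominus> \<one> \<otimes> x \<in> L" using L that by blast
    moreover have "x \<in> carrier R" using L that by blast
    ultimately show ?thesis by (simp add: l_minus)
  qed
  then have "subgroup L (add_monoid R)"
    using L add.subgroupI[of L] by (auto simp: a_inv_def)
  then show "left_ideal L R"
    unfolding left_ideal_def using L additive_subgroup.intro by blast
qed

lemma
  assumes "left_ideal L R"
  shows left_ideal_subset: "L \<subseteq> carrier R"
    and left_ideal_zero: "\<zero> \<in> L"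
    and left_ideal_add: "\<And>x y. \<lbrakk>x \<in> L; y \<in> L\<rbrakk> \<Longrightarrow> x \<oplus> y \<in> L"
    and left_ideal_mult: "\<And>r x. \<lbrakk>r \<in> carrier R; x \<in> L\<rbrakk> \<Longrightarrow> r \<otimes> x \<in> L"
  using assms left_ideal_iff by auto

lemma left_ideal_minus:
  assumes "left_ideal L R" "x \<in> L" "y \<in> L"
  shows "x \<ominus> y \<in> L"
proof -
  have "\<ominus> \<one> \<otimes> y \<in> L" using assms left_ideal_mult by blast
  moreover have "y \<in> carrier R" using assms left_ideal_subset by blast
  ultimately show ?thesis
    using assms left_ideal_add[of L x "\<ominus> y"] by (simp add: a_minus_def l_minus)
qed

lemma left_ideal_carrier: "left_ideal (carrier R) R"
  by (auto simp: left_ideal_iff)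

lemma left_ideal_one:
  assumes "left_ideal L R" "\<one> \<in> L"
  shows "L = carrier R"
proof -
  have "x \<in> L" if "x \<in> carrier R" for x
    using left_ideal_mult[OF assms(1) that assms(2)] that by simp
  then show ?thesis using left_ideal_subset[OF assms(1)] by blast
qed

lemma left_ideal_Inter:
  assumes "\<And>M. M \<in> Q \<Longrightarrow> left_ideal M R"
  shows "left_ideal {x \<in> carrier R. \<forall>M\<in>Q. x \<in> M} R"
  using assms by (auto simp: left_ideal_iff)

lemma left_ideal_Int:
  assumes "left_ideal L R" "left_ideal L' R"
  shows "left_ideal (L \<inter> L') R"
  using assms by (auto simp: left_ideal_iff)

lemma left_ideal_sum_principal:
  assumes "left_ideal L R" "a \<in> carrier R"
  shows "left_ideal {m \<oplus> r \<otimes> a | m r. m \<in> L \<and> r \<in> carrier R} R"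
    and "L \<subseteq> {m \<oplus> r \<otimes> a | m r. m \<in> L \<and> r \<in> carrier R}"
    and "a \<in> {m \<oplus> r \<otimes> a | m r. m \<in> L \<and> r \<in> carrier R}"
proof -
  note L = left_ideal_subset[OF assms(1)]
  have z: "\<zero> \<in> L" by (rule left_ideal_zero[OF assms(1)])
  show sub: "L \<subseteq> {m \<oplus> r \<otimes> a | m r. m \<in> L \<and> r \<in> carrier R}"
  proof
    fix x assume x: "x \<in> L"
    then have "x = x \<oplus> \<zero> \<otimes> a" using L assms(2) by auto
    with x show "x \<in> {m \<oplus> r \<otimes> a | m r. m \<in> L \<and> r \<in> carrier R}" by blast
  qed
  have "a = \<zero> \<oplus> \<one> \<otimes> a" using assms by auto
  with z show "a \<in> {m \<oplus> r \<otimes> a | m r. m \<in> L \<and> r \<in> carrier R}" by blast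
  show "left_ideal {m \<oplus> r \<otimes> a | m r. m \<in> L \<and> r \<in> carrier R} R"
    unfolding left_ideal_iff
  proof (intro conjI ballI)
    show "{m \<oplus> r \<otimes> a | m r. m \<in> L \<and> r \<in> carrier R} \<subseteq> carrier R"
      using L assms by auto
    show "\<zero> \<in> {m \<oplus> r \<otimes> a | m r. m \<in> L \<and> r \<in> carrier R}"
      using sub z by blast
  next
    fix x y
    assume "x \<in> {m \<oplus> r \<otimes> a | m r. m \<in> L \<and> r \<in> carrier R}"
      and "y \<in> {m \<oplus> r \<otimes> a | m r. m \<in> L \<and> r \<in> carrier R}"
    then obtain m r m' r' where *: "m \<in> L" "r \<in> carrier R" "m' \<in> L" "r' \<in> carrier R"
      "x = m \<oplus> r \<otimes> a" "y = m' \<oplus> r' \<otimes> a" by blast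
    then have "x \<oplus> y = (m \<oplus> m') \<oplus> (r \<oplus> r') \<otimes> a"
      using L assms(2) by (simp add: subset_iff l_distr a_ac)
    moreover have "m \<oplus> m' \<in> L" using * left_ideal_add[OF assms(1)] by blast
    ultimately show "x \<oplus> y \<in> {m \<oplus> r \<otimes> a | m r. m \<in> L \<and> r \<in> carrier R}"
      using * by blast
  next
    fix s x
    assume s: "s \<in> carrier R" and "x \<in> {m \<oplus> r \<otimes> a | m r. m \<in> L \<and> r \<in> carrier R}"
    then obtain m r where *: "m \<in> L" "r \<in> carrier R" "x = m \<oplus> r \<otimes> a" by blast
    then have "s \<otimes> x = s \<otimes> m \<oplus> (s \<otimes> r) \<otimes> a"
      using L assms(2) s by (simp add: subset_iff r_distr m_assoc)
    moreover have "s \<otimes> m \<in> L" using * s left_ideal_mult[OF assms(1)] by blast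
    ultimately show "s \<otimes> x \<in> {m \<oplus> r \<otimes> a | m r. m \<in> L \<and> r \<in> carrier R}"
      using * s by blast
  qed
qed

text \<open>Simplicity of the quotient by \<open>M\<close> in terms of elements: \<open>x\<close>
  generates it, so every \<open>y\<close> is a multiple of \<open>x\<close> modulo \<open>M\<close>.
  The length bound below asks for this form only, which annihilators of matrix units satisfy as
  well.\<close>

lemma maximal_left_ideal_cover:
  assumes "maximal_left_ideal M R" "x \<in> carrier R" "x \<notin> M" "y \<in> carrier R"
  shows "\<exists>r \<in> carrier R. y \<ominus> r \<otimes> x \<in> M"
proof -
  have M: "left_ideal M R" using assms(1) maximal_left_ideal_def by blast
  note s = left_ideal_sum_principal[OF M assms(2)]
  then have "{m \<oplus> r \<otimes> x | m r. m \<in> M \<and> r \<in> carrier R} = carrier R"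
    using assms unfolding maximal_left_ideal_def by blast
  then obtain m r where *: "m \<in> M" "r \<in> carrier R" "y = m \<oplus> r \<otimes> x" using assms(4) by blast
  then have "y \<ominus> r \<otimes> x = m"
    using left_ideal_subset[OF M] assms(2) by (simp add: subset_iff a_minus_def a_assoc r_neg)
  then show ?thesis using * by blast
qed

text \<open>A left ideal is assigned the number of indices at which it has a leading term with respect
  to the filtration by the intersections of the final segments of the family.\<close>
lemma left_length_le_of_cosimple_nat:
  fixes M :: "nat \<Rightarrow> 'a set"
  assumes M: "\<And>s. s < N \<Longrightarrow> left_ideal (M s) R"
    and cosimple: "\<And>s x y. \<lbrakk>s < N; x \<in> carrier R; x \<notin> M s; y \<in> carrier R\<rbrakk>
           \<Longrightarrow> \<exists>r \<in> carrier R. y \<ominus> r \<otimes> x \<in> M s"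
    and inter: "\<And>x. \<lbrakk>x \<in> carrier R; \<And>s. s < N \<Longrightarrow> x \<in> M s\<rbrakk> \<Longrightarrow> x = \<zero>"
  shows "left_length_le R N"
proof -
  \<comment> \<open>\<open>F 0\<close> is zero by \<open>inter\<close> and \<open>F N\<close> is the
    whole ring. The factor of \<open>F (Suc t)\<close> by \<open>F t\<close> embeds into the simple
    quotient by \<open>M t\<close>, so a left ideal has at most one jump per index.\<close>
  define F where "F t = {x \<in> carrier R. \<forall>s. t \<le> s \<and> s < N \<longrightarrow> x \<in> M s}" for t
  define S where "S L = {t. t < N \<and> (\<exists>z\<in>L. z \<in> F (Suc t) \<and> z \<notin> F t)}" for L
  have mono: "S L \<subseteq> S L'" if "L \<subseteq> L'" for L L' using that unfolding S_def by blast
  have fin: "finite (S L)" for L unfolding S_def by simp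
  have sub: "L' \<subseteq> L"
    if L: "left_ideal L R" "left_ideal L' R" "L \<subseteq> L'" and eq: "S L' = S L" for L L'
  proof -
    \<comment> \<open>Climb the filtration. If \<open>x\<close> has a leading term at
      \<open>t\<close>, equality of the jump sets gives \<open>z\<close> in \<open>L\<close> with a
      leading term there too; subtracting a multiple of \<open>z\<close> cancels that of
      \<open>x\<close>, and the remainder lies one level lower.\<close>
    have "t \<le> N \<Longrightarrow> L' \<inter> F t \<subseteq> L" for t
    proof (induction t)
      case 0
      have "F 0 \<subseteq> {\<zero>}" unfolding F_def using inter by auto
      then show ?case using left_ideal_zero[OF L(1)] by blast
    next
      case (Suc t)
      show ?case
      proof
        fix x assume x: "x \<in> L' \<inter> F (Suc t)"
        show "x \<in> L"
        proof (cases "x \<in> F t")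
          case True then show ?thesis using Suc x by auto
        next
          case False
          with x Suc have "t \<in> S L'" unfolding S_def by auto
          then obtain z where z: "z \<in> L" "z \<in> F (Suc t)" "z \<notin> F t" using eq unfolding S_def by auto
          have zc: "z \<in> carrier R" "x \<in> carrier R" using z x F_def by auto
          have "z \<notin> M t"
            using z unfolding F_def by (auto simp: Suc_le_eq) (metis le_neq_implies_less)
          then obtain r where r: "r \<in> carrier R" "x \<ominus> r \<otimes> z \<in> M t"
            using cosimple[of t z x] zc Suc by auto
          have "x \<ominus> r \<otimes> z \<in> M s" if "t \<le> s" "s < N" for s
          proof (cases "s = t")
            case False
            then have "x \<in> M s" "z \<in> M s" using z x that unfolding F_def by auto
            then show ?thesis
              using left_ideal_minus[OF M] left_ideal_mult[OF M] that r by blast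
          qed (use r in simp)
          then have "x \<ominus> r \<otimes> z \<in> F t" unfolding F_def using r zc by auto
          moreover have rz: "r \<otimes> z \<in> L" using left_ideal_mult[OF L(1)] r z by blast
          moreover have "x \<ominus> r \<otimes> z \<in> L'"
            using left_ideal_minus[OF L(2)] rz L(3) x by blast
          ultimately have "x \<ominus> r \<otimes> z \<in> L" using Suc by auto
          then have "(x \<ominus> r \<otimes> z) \<oplus> r \<otimes> z \<in> L" using rz left_ideal_add[OF L(1)] by blast
          then show ?thesis using r zc by (simp add: a_minus_def a_assoc l_neg)
        qed
      qed
    qed
    from this[of N] show ?thesis unfolding F_def using left_ideal_subset[OF L(2)] by auto
  qed
  have "card (S L) \<le> N" for L
    using card_mono[of "{..<N}" "S L"] unfolding S_def by auto
  moreover have "card (S L) < card (S L')"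
    if "left_ideal L R" "left_ideal L' R" "L \<subset> L'" for L L'
  proof -
    have "S L \<noteq> S L'" using sub[OF that(1,2)] that(3) by auto
    then show ?thesis using mono[of L L'] that(3) fin by (intro psubset_card_mono) auto
  qed
  ultimately show ?thesis
    unfolding left_length_le_def by (intro exI[of _ "\<lambda>L. card (S L)"]) blast
qed

text \<open>Enumerating the index set reduces to the previous bound. The index sets in use are a
  finite set of maximal left ideals and the set of diagonal positions.\<close>

lemma left_length_le_of_cosimple:
  assumes "finite P"
    and "\<And>s. s \<in> P \<Longrightarrow> left_ideal (M s) R"
    and "\<And>s x y. \<lbrakk>s \<in> P; x \<in> carrier R; x \<notin> M s; y \<in> carrier R\<rbrakk>
           \<Longrightarrow> \<exists>r \<in> carrier R. y \<ominus> r \<otimes> x \<in> M s"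
    and "\<And>x. \<lbrakk>x \<in> carrier R; \<And>s. s \<in> P \<Longrightarrow> x \<in> M s\<rbrakk> \<Longrightarrow> x = \<zero>"
  shows "left_length_le R (card P)"
proof -
  obtain h where h: "bij_betw h {0..<card P} P" using ex_bij_betw_nat_finite[OF assms(1)] by blast
  have hP: "h s \<in> P" if "s < card P" for s using h that by (auto simp: bij_betw_def)
  have hs: "\<exists>s<card P. h s = p" if "p \<in> P" for p
    using h that unfolding bij_betw_def by (metis atLeastLessThan_iff imageE)
  show ?thesis
  proof (rule left_length_le_of_cosimple_nat[of _ "\<lambda>s. M (h s)"])
    show "x = \<zero>" if "x \<in> carrier R" "\<And>s. s < card P \<Longrightarrow> x \<in> M (h s)" for x
      using assms(4)[of x] that hs by metis
  qed (use assms(2,3) hP in blast)+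
qed

section \<open>Semisimple rings: finite length and regularity\<close>

lemma left_artinian_minimal:
  assumes "left_artinian R" "Q \<noteq> {}" "\<And>L. L \<in> Q \<Longrightarrow> left_ideal L R"
  obtains L where "L \<in> Q" "\<And>L'. \<lbrakk>L' \<in> Q; L' \<subseteq> L\<rbrakk> \<Longrightarrow> L' = L"
proof -
  let ?r = "{(I, J). left_ideal I R \<and> left_ideal J R \<and> I \<subset> J}"
  have "wf ?r"
    unfolding wf_iff_no_infinite_down_chain
  proof
    assume "\<exists>f. \<forall>i. (f (Suc i), f i) \<in> ?r"
    then obtain f where f: "\<And>i. left_ideal (f i) R \<and> f (Suc i) \<subset> f i" by blast
    then have "\<forall>k. left_ideal (f k) R \<and> f (Suc k) \<subseteq> f k" by blast
    then have "\<exists>N. \<forall>k\<ge>N. f k = f N" using assms(1) unfolding left_artinian_def by blast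
    then obtain N where "\<forall>k\<ge>N. f k = f N" ..
    then have "f (Suc N) = f N" by (metis le_Suc_eq order_refl)
    then show False using f[of N] by blast
  qed
  then obtain L where "L \<in> Q" "\<And>L'. (L', L) \<in> ?r \<Longrightarrow> L' \<notin> Q"
    using assms(2) by (meson wf_eq_minimal equals0I)
  then show ?thesis using that[of L] assms(3) by blast
qed

text \<open>Among finite intersections of maximal left ideals a minimal one exists. It is zero: a
  nonzero element is missed by some maximal left ideal, and adjoining that ideal would shrink the
  intersection.\<close>

lemma left_length_le_of_semisimple:
  assumes "left_artinian R" "jacobson_radical R = {\<zero>}"
  shows "\<exists>N. left_length_le R N"
proof -
  define C where "C Q = {x \<in> carrier R. \<forall>M\<in>Q. x \<in> M}" for Q
  let ?U = "{Q. finite Q \<and> (\<forall>M\<in>Q. maximal_left_ideal M R)}"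
  have li: "left_ideal M R" if "Q \<in> ?U" "M \<in> Q" for Q M
    using that maximal_left_ideal_def by auto
  have C: "left_ideal (C Q) R" if "Q \<in> ?U" for Q
    unfolding C_def using li[OF that] by (rule left_ideal_Inter)
  have "C ` ?U \<noteq> {}" by blast
  moreover have "left_ideal L R" if "L \<in> C ` ?U" for L using that C by blast
  ultimately obtain L where L: "L \<in> C ` ?U" "\<And>L'. \<lbrakk>L' \<in> C ` ?U; L' \<subseteq> L\<rbrakk> \<Longrightarrow> L' = L"
    by (rule left_artinian_minimal[OF assms(1)]) blast+
  then obtain Q where Q: "Q \<in> ?U" "L = C Q" by blast
  have zero: "x = \<zero>" if x: "x \<in> C Q" for x
  proof (rule ccontr)
    assume "x \<noteq> \<zero>"
    then have "x \<notin> jacobson_radical R" using assms(2) by simp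
    then obtain M where M: "maximal_left_ideal M R" "x \<notin> M"
      using x unfolding C_def jacobson_radical_def by blast
    then have "C (insert M Q) \<in> C ` ?U" using Q by blast
    moreover have "C (insert M Q) \<subseteq> L" unfolding Q(2) C_def by blast
    ultimately have "C (insert M Q) = C Q" using L Q by blast
    then show False using x M unfolding C_def by blast
  qed
  have "left_length_le R (card Q)"
  proof (rule left_length_le_of_cosimple[of _ "\<lambda>M. M"])
    show "x = \<zero>" if "x \<in> carrier R" "\<And>s. s \<in> Q \<Longrightarrow> x \<in> s" for x
      using that zero unfolding C_def by blast
    show "\<exists>r\<in>carrier R. y \<ominus> r \<otimes> x \<in> s"
      if "s \<in> Q" "x \<in> carrier R" "x \<notin> s" "y \<in> carrier R" for s x y
      using maximal_left_ideal_cover Q that by blast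
  qed (use Q li in auto)
  then show ?thesis by blast
qed

text \<open>A left ideal minimal among the supplements of \<open>R a\<close> is a complement, and the component of
  \<open>\<one>\<close> in \<open>R a\<close> gives the quasi-inverse.\<close>
lemma von_neumann_regular_of_semisimple:
  assumes "left_artinian R" "jacobson_radical R = {\<zero>}"
  shows "von_neumann_regular R"
  unfolding von_neumann_regular_def
proof
  fix a assume a: "a \<in> carrier R"
  define Q where "Q = {L. left_ideal L R \<and> (\<exists>r\<in>carrier R. \<one> \<ominus> r \<otimes> a \<in> L)}"
  have "carrier R \<in> Q" unfolding Q_def using left_ideal_carrier a by blast
  then have "Q \<noteq> {}" by blast
  moreover have "left_ideal L R" if "L \<in> Q" for L using that unfolding Q_def by blast
  ultimately obtain L where L: "L \<in> Q" "\<And>L'. \<lbrakk>L' \<in> Q; L' \<subseteq> L\<rbrakk> \<Longrightarrow> L' = L"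
    by (rule left_artinian_minimal[OF assms(1)]) blast+
  then obtain r where r: "r \<in> carrier R" "\<one> \<ominus> r \<otimes> a \<in> L" and Ll: "left_ideal L R"
    unfolding Q_def by blast
  \<comment> \<open>The sum of \<open>L\<close> with the multiples of \<open>a\<close> is direct. A
    nonzero \<open>s \<otimes> a\<close> in \<open>L\<close> avoids some maximal \<open>M\<close>;
    correcting \<open>r\<close> by \<open>t \<otimes> s\<close> shows that
    \<open>L \<inter> M\<close> is still a supplement, against minimality of
    \<open>L\<close>.\<close>
  have zero: "s \<otimes> a = \<zero>" if s: "s \<in> carrier R" "s \<otimes> a \<in> L" for s
  proof (rule ccontr)
    assume "s \<otimes> a \<noteq> \<zero>"
    then have "s \<otimes> a \<notin> jacobson_radical R" using assms(2) by simp
    then obtain M where M: "maximal_left_ideal M R" "s \<otimes> a \<notin> M"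
      using s a unfolding jacobson_radical_def by blast
    then have Ml: "left_ideal M R" unfolding maximal_left_ideal_def by blast
    obtain t where t: "t \<in> carrier R" "(\<one> \<ominus> r \<otimes> a) \<ominus> t \<otimes> (s \<otimes> a) \<in> M"
      using maximal_left_ideal_cover[OF M(1) _ M(2)] s a r by (metis left_ideal_subset[OF Ll] m_closed subset_iff)
    have "(\<one> \<ominus> r \<otimes> a) \<ominus> t \<otimes> (s \<otimes> a) \<in> L"
      using left_ideal_minus[OF Ll r(2)] left_ideal_mult[OF Ll t(1) s(2)] by blast
    moreover have "(\<one> \<ominus> r \<otimes> a) \<ominus> t \<otimes> (s \<otimes> a) = \<one> \<ominus> (r \<oplus> t \<otimes> s) \<otimes> a"
      using r s t a by (simp add: a_minus_def l_distr m_assoc minus_add a_assoc)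
    ultimately have "L \<inter> M \<in> Q"
      unfolding Q_def using left_ideal_Int[OF Ll Ml] r s t by auto
    then have "L \<inter> M = L" using L by blast
    then show False using s M by blast
  qed
  \<comment> \<open>This element lies in \<open>L\<close> and, by the next equation, is also a left
    multiple of \<open>a\<close>; directness makes it vanish.\<close>
  have "a \<otimes> (\<one> \<ominus> r \<otimes> a) \<in> L" using left_ideal_mult[OF Ll a r(2)] .
  moreover have eq: "a \<otimes> (\<one> \<ominus> r \<otimes> a) = (\<one> \<ominus> a \<otimes> r) \<otimes> a"
    using a r by (simp add: a_minus_def l_distr r_distr l_minus r_minus m_assoc)
  ultimately have "(\<one> \<ominus> a \<otimes> r) \<otimes> a = \<zero>" using zero[of "\<one> \<ominus> a \<otimes> r"] a r by simp
  then have "a \<ominus> a \<otimes> r \<otimes> a = \<zero>" using a r by (simp add: a_minus_def l_distr l_minus)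
  then have "a \<otimes> r \<otimes> a = a" using a r by simp
  then show "\<exists>r\<in>carrier R. a \<otimes> r \<otimes> a = a" using r by blast
qed

section \<open>The radical of a regular ring\<close>

lemma maximal_left_ideal_exists:
  assumes "left_ideal L R" "\<one> \<notin> L"
  obtains M where "maximal_left_ideal M R" "L \<subseteq> M"
proof -
  \<comment> \<open>Properness is recorded as absence of \<open>\<one>\<close>, a property that
    survives unions of chains.\<close>
  define Q where "Q = {I. left_ideal I R \<and> \<one> \<notin> I \<and> L \<subseteq> I}"
  have "\<exists>M\<in>Q. \<forall>I\<in>Q. M \<subseteq> I \<longrightarrow> I = M"
  proof (rule subset_Zorn_nonempty)
    show "Q \<noteq> {}" using assms Q_def by blast
    fix C assume C: "C \<noteq> {}" "subset.chain Q C"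
    then have CX: "C \<subseteq> Q" and tot: "\<And>I J. I \<in> C \<Longrightarrow> J \<in> C \<Longrightarrow> I \<subseteq> J \<or> J \<subseteq> I"
      by (auto simp: subset_chain_def)
    have "left_ideal (\<Union>C) R"
      unfolding left_ideal_iff
    proof (intro conjI ballI)
      show "\<Union>C \<subseteq> carrier R" using CX left_ideal_subset unfolding Q_def by blast
      show "\<zero> \<in> \<Union>C" using CX C(1) left_ideal_zero unfolding Q_def by blast
      fix x y assume "x \<in> \<Union>C" "y \<in> \<Union>C"
      then obtain I where "I \<in> C" "x \<in> I" "y \<in> I" using tot by blast
      then show "x \<oplus> y \<in> \<Union>C" using CX left_ideal_add unfolding Q_def by blast
    next
      fix r x assume "r \<in> carrier R" "x \<in> \<Union>C"
      then show "r \<otimes> x \<in> \<Union>C" using CX left_ideal_mult unfolding Q_def by blast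
    qed
    then show "\<Union>C \<in> Q" using CX C(1) unfolding Q_def by blast
  qed
  then obtain M where M: "M \<in> Q" "\<And>I. \<lbrakk>I \<in> Q; M \<subseteq> I\<rbrakk> \<Longrightarrow> I = M" by blast
  have "maximal_left_ideal M R"
    unfolding maximal_left_ideal_def
  proof (intro conjI allI impI)
    show "left_ideal M R" "M \<noteq> carrier R" using M unfolding Q_def by auto
    fix I assume I: "left_ideal I R \<and> M \<subseteq> I"
    show "I = M \<or> I = carrier R"
    proof (cases "\<one> \<in> I")
      case True then show ?thesis using I left_ideal_one by blast
    next
      case False then have "I \<in> Q" using I M(1) unfolding Q_def by blast
      then show ?thesis using M I by blast
    qed
  qed
  then show ?thesis using that M(1) unfolding Q_def by blast
qed

text \<open>With x = x y x, the idempotent e = y x lies in every maximal left ideal. If the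
  annihilator of \<open>e\<close> were proper, a maximal left ideal above it would contain both
  \<open>\<one> \<ominus> e\<close> and \<open>e\<close>. So \<open>\<one>\<close> annihilates
  \<open>e\<close>, and x = x e is zero.\<close>

lemma jacobson_radical_of_von_neumann_regular:
  assumes "von_neumann_regular R"
  shows "jacobson_radical R = {\<zero>}"
proof
  show "{\<zero>} \<subseteq> jacobson_radical R"
    unfolding jacobson_radical_def maximal_left_ideal_def using left_ideal_zero by blast
  show "jacobson_radical R \<subseteq> {\<zero>}"
  proof
    fix x assume x: "x \<in> jacobson_radical R"
    then have xc: "x \<in> carrier R" unfolding jacobson_radical_def by blast
    then obtain y where y: "y \<in> carrier R" "x \<otimes> y \<otimes> x = x"
      using assms unfolding von_neumann_regular_def by blast
    define e where "e = y \<otimes> x"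
    have e: "e \<in> carrier R" "e \<otimes> e = e" "x \<otimes> e = x"
      unfolding e_def using xc y by (auto simp: m_assoc)
    let ?L = "{a \<in> carrier R. a \<otimes> e = \<zero>}"
    have L: "left_ideal ?L R"
      using e by (auto simp: left_ideal_iff l_distr m_assoc)
    have "\<one> \<in> ?L"
    proof (rule ccontr)
      assume "\<one> \<notin> ?L"
      then obtain M where M: "maximal_left_ideal M R" "?L \<subseteq> M"
        using maximal_left_ideal_exists[OF L] by blast
      have Ml: "left_ideal M R" "M \<noteq> carrier R" using M maximal_left_ideal_def by auto
      have "\<one> \<ominus> e \<in> ?L" using e by (auto simp: a_minus_def l_distr l_minus r_neg)
      moreover have "e \<in> M"
        unfolding e_def using left_ideal_mult[OF Ml(1) y(1)] x M(1)
        unfolding jacobson_radical_def by blast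
      ultimately have "(\<one> \<ominus> e) \<oplus> e \<in> M" using M(2) left_ideal_add[OF Ml(1)] by blast
      then have "\<one> \<in> M" using e by (simp add: a_minus_def a_assoc l_neg)
      then show False using left_ideal_one Ml by blast
    qed
    then have "e = \<zero>" using e by auto
    then show "x \<in> {\<zero>}" using e xc by auto
  qed
qed

end

subsection \<open>Extensions absorbed by a subring\<close>

definition opposite_ring :: "('a, 'm) ring_scheme \<Rightarrow> ('a, 'm) ring_scheme" where
  "opposite_ring R = R\<lparr>monoid.mult := \<lambda>x y. y \<otimes>\<^bsub>R\<^esub> x\<rparr>"

lemma opposite_ring_simps [simp]:
  "carrier (opposite_ring R) = carrier R"
  "x \<otimes>\<^bsub>opposite_ring R\<^esub> y = y \<otimes>\<^bsub>R\<^esub> x"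
  "\<one>\<^bsub>opposite_ring R\<^esub> = \<one>\<^bsub>R\<^esub>"
  "\<zero>\<^bsub>opposite_ring R\<^esub> = \<zero>\<^bsub>R\<^esub>"
  "x \<oplus>\<^bsub>opposite_ring R\<^esub> y = x \<oplus>\<^bsub>R\<^esub> y"
  by (simp_all add: opposite_ring_def)

lemma add_monoid_opposite_ring: "add_monoid (opposite_ring R) = add_monoid R"
  by (simp add: opposite_ring_def)

lemma ring_opposite_ring:
  assumes "ring R"
  shows "ring (opposite_ring R)"
proof -
  interpret R: ring R by fact
  show ?thesis
  proof (rule ringI)
    show "abelian_group (opposite_ring R)"
      using R.abelian_group_axioms
      unfolding abelian_group_def abelian_group_axioms_def abelian_monoid_def
        add_monoid_opposite_ring by (simp add: opposite_ring_def)
    show "Group.monoid (opposite_ring R)"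
      by (rule monoidI) (auto simp: R.m_assoc)
  qed (auto simp: R.l_distr R.r_distr)
qed

lemma left_ideal_opposite_ring: "left_ideal L (opposite_ring R) \<longleftrightarrow> right_ideal L R"
  unfolding left_ideal_def right_ideal_def additive_subgroup_def add_monoid_opposite_ring by simp

lemma artinian_iff_left_artinian:
  "artinian R \<longleftrightarrow> left_artinian R \<and> left_artinian (opposite_ring R)"
  unfolding artinian_def left_artinian_def left_ideal_opposite_ring ..

lemma von_neumann_regular_opposite_ring:
  assumes "ring R" "von_neumann_regular R"
  shows "von_neumann_regular (opposite_ring R)"
proof -
  interpret R: ring R by fact
  show ?thesis
    using assms(2) by (auto simp: von_neumann_regular_def R.m_assoc)
qed

text \<open>The maps \<open>T l\<close> are the powers of the automorphism extending \<open>\<sigma>\<close>.\<close>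
locale absorbing_extension =
  fixes R :: "('a, 'r) ring_scheme" and A :: "('a, 's) ring_scheme" and T :: "nat \<Rightarrow> 'a \<Rightarrow> 'a"
  assumes ring_R: "ring R" and ring_A: "ring A"
    and incl: "(\<lambda>x. x) \<in> ring_hom R A"
    and T_iso: "\<And>l. T l \<in> ring_iso A A"
    and absorb: "\<And>Q. \<lbrakk>finite Q; Q \<subseteq> carrier A\<rbrakk> \<Longrightarrow> \<exists>l. \<forall>x\<in>Q. T l x \<in> carrier R"
begin

sublocale R: ring R by (rule ring_R)
sublocale A: ring A by (rule ring_A)

lemma carrier_sub: "x \<in> carrier R \<Longrightarrow> x \<in> carrier A"
  using ring_hom_closed[OF incl] by simp

lemma mult_eq: "\<lbrakk>x \<in> carrier R; y \<in> carrier R\<rbrakk> \<Longrightarrow> x \<otimes>\<^bsub>R\<^esub> y = x \<otimes>\<^bsub>A\<^esub> y"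
  using ring_hom_mult[OF incl] by simp

lemma add_eq: "\<lbrakk>x \<in> carrier R; y \<in> carrier R\<rbrakk> \<Longrightarrow> x \<oplus>\<^bsub>R\<^esub> y = x \<oplus>\<^bsub>A\<^esub> y"
  using ring_hom_add[OF incl] by simp

lemma one_eq: "\<one>\<^bsub>R\<^esub> = \<one>\<^bsub>A\<^esub>"
  using ring_hom_one[OF incl] by simp

lemma zero_eq: "\<zero>\<^bsub>R\<^esub> = \<zero>\<^bsub>A\<^esub>"
  using ring_hom_zero[OF incl ring_R ring_A] by simp

lemma T_hom: "T l \<in> ring_hom A A"
  and T_bij: "bij_betw (T l) (carrier A) (carrier A)"
  using T_iso[of l] by (auto simp: ring_iso_def)

lemma T_closed: "x \<in> carrier A \<Longrightarrow> T l x \<in> carrier A"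
  using ring_hom_closed[OF T_hom] .

lemma T_mult: "\<lbrakk>x \<in> carrier A; y \<in> carrier A\<rbrakk> \<Longrightarrow> T l (x \<otimes>\<^bsub>A\<^esub> y) = T l x \<otimes>\<^bsub>A\<^esub> T l y"
  using ring_hom_mult[OF T_hom] .

lemma T_add: "\<lbrakk>x \<in> carrier A; y \<in> carrier A\<rbrakk> \<Longrightarrow> T l (x \<oplus>\<^bsub>A\<^esub> y) = T l x \<oplus>\<^bsub>A\<^esub> T l y"
  using ring_hom_add[OF T_hom] .

lemma T_one: "T l \<one>\<^bsub>A\<^esub> = \<one>\<^bsub>A\<^esub>"
  using ring_hom_one[OF T_hom] .

lemma T_zero: "T l \<zero>\<^bsub>A\<^esub> = \<zero>\<^bsub>A\<^esub>"
  using ring_hom_zero[OF T_hom ring_A ring_A] .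

lemma T_inj: "\<lbrakk>x \<in> carrier A; y \<in> carrier A; T l x = T l y\<rbrakk> \<Longrightarrow> x = y"
  using T_bij[of l] by (auto simp: bij_betw_def inj_on_def)

lemma T_eq_zero_iff: "x \<in> carrier A \<Longrightarrow> T l x = \<zero>\<^bsub>A\<^esub> \<longleftrightarrow> x = \<zero>\<^bsub>A\<^esub>"
  by (metis T_inj T_zero A.zero_closed)

lemma T_surj:
  assumes "y \<in> carrier A"
  obtains x where "x \<in> carrier A" "T l x = y"
proof -
  have "y \<in> T l ` carrier A" using T_bij[of l] assms by (simp add: bij_betw_def)
  then show thesis using that by blast
qed

text \<open>The pattern of every transfer: move the elements into \<open>R\<close>, solve there, and
  pull the solution back by surjectivity and injectivity of \<open>T l\<close>.\<close>

lemma von_neumann_regular_extension: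
  assumes "von_neumann_regular R"
  shows "von_neumann_regular A"
  unfolding von_neumann_regular_def
proof
  fix a assume a: "a \<in> carrier A"
  then obtain l where l: "T l a \<in> carrier R" using absorb[of "{a}"] by auto
  then obtain r where r: "r \<in> carrier R" "T l a \<otimes>\<^bsub>R\<^esub> r \<otimes>\<^bsub>R\<^esub> T l a = T l a"
    using assms unfolding von_neumann_regular_def by blast
  obtain s where s: "s \<in> carrier A" "T l s = r" using T_surj[OF carrier_sub[OF r(1)]] .
  have "T l (a \<otimes>\<^bsub>A\<^esub> s \<otimes>\<^bsub>A\<^esub> a) = T l a"
    using a s l r by (simp add: T_mult mult_eq[symmetric])
  then show "\<exists>r\<in>carrier A. a \<otimes>\<^bsub>A\<^esub> r \<otimes>\<^bsub>A\<^esub> a = a"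
    using T_inj[OF _ a] a s by (intro bexI[of _ s]) auto
qed

text \<open>Since \<open>T l\<close> maps onto \<open>A\<close>, a scalar from \<open>R\<close> is
  the image of a scalar from \<open>A\<close>; hence the image of \<open>L\<close> absorbs
  multiplication by \<open>R\<close>.\<close>

lemma left_ideal_restrict:
  assumes L: "left_ideal L A"
  shows "left_ideal (T l ` L \<inter> carrier R) R"
  unfolding R.left_ideal_iff
proof (intro conjI ballI)
  note sub = A.left_ideal_subset[OF L]
  show "T l ` L \<inter> carrier R \<subseteq> carrier R" by simp
  have "T l \<zero>\<^bsub>A\<^esub> \<in> T l ` L" using A.left_ideal_zero[OF L] by blast
  then show "\<zero>\<^bsub>R\<^esub> \<in> T l ` L \<inter> carrier R"
    using R.zero_closed by (simp add: T_zero zero_eq)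
  show "x \<oplus>\<^bsub>R\<^esub> y \<in> T l ` L \<inter> carrier R"
    if x: "x \<in> T l ` L \<inter> carrier R" and y: "y \<in> T l ` L \<inter> carrier R" for x y
  proof -
    obtain u v where *: "u \<in> L" "v \<in> L" "x = T l u" "y = T l v" using x y by blast
    have "x \<oplus>\<^bsub>R\<^esub> y = T l (u \<oplus>\<^bsub>A\<^esub> v)"
      using x y * sub by (simp add: add_eq T_add subset_iff)
    moreover have "x \<oplus>\<^bsub>R\<^esub> y \<in> carrier R" using x y by simp
    ultimately show ?thesis using A.left_ideal_add[OF L *(1,2)] by blast
  qed
  show "r \<otimes>\<^bsub>R\<^esub> x \<in> T l ` L \<inter> carrier R"
    if r: "r \<in> carrier R" and x: "x \<in> T l ` L \<inter> carrier R" for r x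
  proof -
    obtain u where u: "u \<in> L" "x = T l u" using x by blast
    obtain s where s: "s \<in> carrier A" "T l s = r" using T_surj[OF carrier_sub[OF r]] .
    have "r \<otimes>\<^bsub>R\<^esub> x = T l (s \<otimes>\<^bsub>A\<^esub> u)"
      using x r u s sub by (simp add: mult_eq T_mult subset_iff)
    moreover have "r \<otimes>\<^bsub>R\<^esub> x \<in> carrier R" using r x by simp
    ultimately show ?thesis using A.left_ideal_mult[OF L s(1) u(1)] by blast
  qed
qed

text \<open>Of an infinite strict descent in \<open>A\<close> only the first N + 1 steps are used.
  One witness per step makes a finite set, a single \<open>T l\<close> brings it into
  \<open>R\<close>, and the restricted left ideals there form a chain too long for the
  bound.\<close>

lemma left_artinian_extension:
  assumes "left_length_le R N"
  shows "left_artinian A"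
  unfolding left_artinian_def
proof (intro allI impI, rule ccontr)
  fix I :: "nat \<Rightarrow> 'a set"
  assume I: "\<forall>k. left_ideal (I k) A \<and> I (Suc k) \<subseteq> I k"
    and "\<not> (\<exists>N. \<forall>k\<ge>N. I k = I N)"
  then have ex: "\<exists>k. I k \<subset> I n" for n
  proof -
    obtain k where "k \<ge> n" "I k \<noteq> I n" using \<open>\<not> (\<exists>N. \<forall>k\<ge>N. I k = I N)\<close> by blast
    moreover have "I k \<subseteq> I n" using lift_Suc_antimono_le[of I n k] I \<open>k \<ge> n\<close> by blast
    ultimately show ?thesis by blast
  qed
  \<comment> \<open>Repetitions in the chain are skipped, so that every step of the subsequence is
    strict.\<close>
  define f where "f j = ((\<lambda>n. SOME k. I k \<subset> I n) ^^ j) 0" for j :: nat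
  have strict: "I (f (Suc j)) \<subset> I (f j)" for j
    unfolding f_def using someI_ex[OF ex] by simp
  then have "\<forall>j. \<exists>x. x \<in> I (f j) \<and> x \<notin> I (f (Suc j))" by blast
  then obtain x where x: "\<And>j. x j \<in> I (f j) \<and> x j \<notin> I (f (Suc j))" by metis
  have sub: "I k \<subseteq> carrier A" for k using I A.left_ideal_subset by blast
  then have "x ` {..N} \<subseteq> carrier A" using x by blast
  then obtain l where l: "\<And>j. j \<le> N \<Longrightarrow> T l (x j) \<in> carrier R" using absorb[of "x ` {..N}"] by auto
  define B where "B j = T l ` I (f j) \<inter> carrier R" for j
  have B: "left_ideal (B j) R" for j unfolding B_def using left_ideal_restrict I by blast
  have B_strict: "B (Suc j) \<subset> B j" if "j \<le> N" for j
  proof -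
    have "T l (x j) \<in> B j" unfolding B_def using x l[OF that] by blast
    moreover have "T l (x j) \<notin> B (Suc j)"
    proof
      assume "T l (x j) \<in> B (Suc j)"
      then obtain u where u: "u \<in> I (f (Suc j))" "T l u = T l (x j)" unfolding B_def by force
      moreover have "u \<in> carrier A" "x j \<in> carrier A" using u sub x by blast+
      ultimately show False using T_inj x by metis
    qed
    moreover have "B (Suc j) \<subseteq> B j" unfolding B_def using strict by blast
    ultimately show ?thesis by blast
  qed
  obtain len :: "'a set \<Rightarrow> nat" where len: "\<And>L. left_ideal L R \<Longrightarrow> len L \<le> N"
      "\<And>L L'. \<lbrakk>left_ideal L R; left_ideal L' R; L \<subset> L'\<rbrakk> \<Longrightarrow> len L < len L'"
    using assms unfolding left_length_le_def by blast
  \<comment> \<open>The rank falls by at least one per strict step. There are N + 1 such steps, from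
    \<open>B 0\<close> to \<open>B (Suc N)\<close>, but only N + 1 possible ranks.\<close>
  have "j \<le> Suc N \<Longrightarrow> len (B j) + j \<le> N" for j
  proof (induction j)
    case 0 then show ?case using len(1)[OF B] by simp
  next
    case (Suc j)
    then show ?case using len(2)[OF B B B_strict[of j]] by simp
  qed
  from this[of "Suc N"] show False by simp
qed

lemma absorbing_extension_opposite:
  "absorbing_extension (opposite_ring R) (opposite_ring A) T"
proof (rule absorbing_extension.intro)
  show "ring (opposite_ring R)" "ring (opposite_ring A)"
    using ring_opposite_ring ring_R ring_A by auto
  show "(\<lambda>x. x) \<in> ring_hom (opposite_ring R) (opposite_ring A)"
    by (rule ring_hom_memI) (auto simp: carrier_sub mult_eq add_eq one_eq)
  show "T l \<in> ring_iso (opposite_ring A) (opposite_ring A)" for l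
    using T_bij[of l] unfolding ring_iso_def
    by (auto intro!: ring_hom_memI simp: T_closed T_mult T_add T_one)
  show "\<exists>l. \<forall>x\<in>Q. T l x \<in> carrier (opposite_ring R)"
    if "finite Q" "Q \<subseteq> carrier (opposite_ring A)" for Q
    using absorb that by simp
qed

lemma semisimple_extension:
  assumes "semisimple_ring R"
  shows "semisimple_ring A"
proof -
  have art: "left_artinian R" "left_artinian (opposite_ring R)"
    and J: "jacobson_radical R = {\<zero>\<^bsub>R\<^esub>}"
    using assms by (auto simp: semisimple_ring_def artinian_iff_left_artinian)
  interpret O: absorbing_extension "opposite_ring R" "opposite_ring A" T
    by (rule absorbing_extension_opposite)
  have reg: "von_neumann_regular R" using R.von_neumann_regular_of_semisimple[OF art(1) J] .
  \<comment> \<open>The radical of the opposite ring is formed from right ideals of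
    \<open>R\<close>, about which the hypothesis on the radical is silent. Regularity bridges the
    two sides.\<close>
  then have "von_neumann_regular (opposite_ring R)"
    using von_neumann_regular_opposite_ring[OF ring_R] by blast
  then have JO: "jacobson_radical (opposite_ring R) = {\<zero>\<^bsub>opposite_ring R\<^esub>}"
    by (rule O.R.jacobson_radical_of_von_neumann_regular)
  have "left_artinian A"
    using R.left_length_le_of_semisimple[OF art(1) J] left_artinian_extension by blast
  moreover have "left_artinian (opposite_ring A)"
    using O.R.left_length_le_of_semisimple[OF art(2) JO] O.left_artinian_extension by blast
  ultimately show ?thesis
    using A.jacobson_radical_of_von_neumann_regular[OF von_neumann_regular_extension[OF reg]] ring_A
    by (simp add: semisimple_ring_def artinian_iff_left_artinian)
qed

end

text \<open>On \<open>R\<close> the automorphism agrees with \<open>\<sigma>\<close> and so stays in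
  \<open>R\<close>. Elements once absorbed remain absorbed, and the exponents for the members of a
  finite set may simply be added.\<close>

lemma absorbing_extension_of_jordan:
  assumes "ring R" "\<sigma> \<in> ring_hom R R" "jordan_extension R \<sigma> A"
  shows "\<exists>T. absorbing_extension R A T"
proof -
  obtain \<tau> where \<tau>: "\<tau> \<in> ring_iso A A" "\<And>x. x \<in> carrier R \<Longrightarrow> \<tau> x = \<sigma> x"
      and un: "carrier A = (\<Union>i :: nat. {a \<in> carrier A. (\<tau> ^^ i) a \<in> carrier R})"
      and A: "ring A" "(\<lambda>x. x) \<in> ring_hom R A"
    using assms(3) unfolding jordan_extension_def by blast
  have iso: "\<tau> ^^ l \<in> ring_iso A A" for l
  proof (induction l)
    case 0
    have "id \<in> ring_iso A A" by (simp add: ring_iso_def)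
    then show ?case by (simp add: id_def[symmetric])
  next
    case (Suc l) then show ?case using ring_iso_set_trans[OF Suc \<tau>(1)] by (simp add: comp_def)
  qed
  have shift: "(\<tau> ^^ (k + l)) a \<in> carrier R" if "(\<tau> ^^ l) a \<in> carrier R" for k l a
  proof (induction k)
    case (Suc k)
    then have "\<tau> ((\<tau> ^^ (k + l)) a) \<in> carrier R"
      using \<tau>(2)[OF Suc] ring_hom_closed[OF assms(2) Suc] by argo
    then show ?case by simp
  qed (use that in simp)
  have "\<exists>l. \<forall>x\<in>Q. (\<tau> ^^ l) x \<in> carrier R" if "finite Q" "Q \<subseteq> carrier A" for Q
    using that
  proof (induction Q)
    case (insert a Q)
    then obtain l where l: "\<And>x. x \<in> Q \<Longrightarrow> (\<tau> ^^ l) x \<in> carrier R" by auto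
    have "a \<in> (\<Union>i :: nat. {a \<in> carrier A. (\<tau> ^^ i) a \<in> carrier R})"
      using un insert.prems by blast
    then obtain k where "(\<tau> ^^ k) a \<in> carrier R" by blast
    then have "(\<tau> ^^ (k + l)) a \<in> carrier R" using shift[of k a l] by (simp only: add.commute)
    moreover have "(\<tau> ^^ (k + l)) x \<in> carrier R" if "x \<in> Q" for x using shift[OF l[OF that]] .
    ultimately show ?case by (intro exI[of _ "k + l"]) simp
  qed simp
  then have "absorbing_extension R A (\<lambda>l. \<tau> ^^ l)"
    using assms(1) A iso by (intro absorbing_extension.intro) simp_all
  then show ?thesis by blast
qed

subsection \<open>Matrix units with simple blocks\<close>

text \<open>For idempotents e and f, the set e R f describes the homomorphisms from R e to R f. Thus
  the first clause says that distinct blocks admit none, the second that each corner is a division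
  ring. The inverse is asked for on the left only and anywhere in the ring, which is the form
  simplicity of a left ideal delivers.\<close>

definition simple_blocks :: "('a, 'r) ring_scheme \<Rightarrow> 'i set \<Rightarrow> ('i \<Rightarrow> nat \<Rightarrow> nat \<Rightarrow> 'a) \<Rightarrow> bool" where
  "simple_blocks R I e \<longleftrightarrow>
     (\<forall>i\<in>I. \<forall>i'\<in>I. \<forall>x\<in>carrier R. i \<noteq> i' \<longrightarrow> e i 0 0 \<otimes>\<^bsub>R\<^esub> x \<otimes>\<^bsub>R\<^esub> e i' 0 0 = \<zero>\<^bsub>R\<^esub>) \<and>
     (\<forall>i\<in>I. \<forall>x\<in>carrier R. e i 0 0 \<otimes>\<^bsub>R\<^esub> x \<otimes>\<^bsub>R\<^esub> e i 0 0 \<noteq> \<zero>\<^bsub>R\<^esub> \<longrightarrow>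
        (\<exists>y\<in>carrier R. y \<otimes>\<^bsub>R\<^esub> (e i 0 0 \<otimes>\<^bsub>R\<^esub> x \<otimes>\<^bsub>R\<^esub> e i 0 0) = e i 0 0))"

locale matrix_units = ring R for R :: "('a, 'r) ring_scheme" (structure) +
  fixes I :: "'i set" and m :: "'i \<Rightarrow> nat" and e :: "'i \<Rightarrow> nat \<Rightarrow> nat \<Rightarrow> 'a"
  assumes finite_I: "finite I"
    and m_pos: "i \<in> I \<Longrightarrow> 0 < m i"
    and e_closed: "\<lbrakk>i \<in> I; j < m i; k < m i\<rbrakk> \<Longrightarrow> e i j k \<in> carrier R"
    and e_mult_same: "\<lbrakk>i \<in> I; j < m i; k < m i; l < m i\<rbrakk> \<Longrightarrow> e i j k \<otimes> e i k l = e i j l"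
    and e_mult_diff: "\<lbrakk>i \<in> I; j < m i; k < m i; i' \<in> I; j' < m i'; k' < m i'; i \<noteq> i' \<or> k \<noteq> j'\<rbrakk>
           \<Longrightarrow> e i j k \<otimes> e i' j' k' = \<zero>"
    and e_nonzero: "i \<in> I \<Longrightarrow> e i 0 0 \<noteq> \<zero>"
    and e_sum: "(\<Oplus>p\<in>(SIGMA i:I. {..<m i}). e (fst p) (snd p) (snd p)) = \<one>"
begin

abbreviation positions :: "('i \<times> nat) set" where
  "positions \<equiv> SIGMA i:I. {..<m i}"

abbreviation u :: "'i \<times> nat \<Rightarrow> 'a" where
  "u p \<equiv> e (fst p) (snd p) (snd p)"

lemma finite_positions: "finite positions"
  using finite_I by simp

lemma u_closed: "p \<in> positions \<Longrightarrow> u p \<in> carrier R"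
  using e_closed by auto

lemma u_idem: "p \<in> positions \<Longrightarrow> u p \<otimes> u p = u p"
  using e_mult_same by auto

lemma u_orth: "\<lbrakk>p \<in> positions; q \<in> positions; p \<noteq> q\<rbrakk> \<Longrightarrow> u p \<otimes> u q = \<zero>"
  using e_mult_diff by (auto simp: prod_eq_iff)

lemma e_mult_same_assoc:
  assumes "i \<in> I" "j < m i" "k < m i" "l < m i" "x \<in> carrier R"
  shows "e i j k \<otimes> (e i k l \<otimes> x) = e i j l \<otimes> x"
  using assms e_closed e_mult_same by (simp add: m_assoc[symmetric])

text \<open>The unit \<open>e i 0 0\<close> factors through every diagonal unit of its block, so
  nonvanishing spreads from it.\<close>

lemma u_nonzero:
  assumes "p \<in> positions"
  shows "u p \<noteq> \<zero>"
proof
  obtain i j where p: "p = (i, j)" "i \<in> I" "j < m i" using assms by auto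
  assume "u p = \<zero>"
  then have "e i 0 j \<otimes> e i j j \<otimes> e i j 0 = \<zero>" using p m_pos e_closed by simp
  then show False using p m_pos e_mult_same e_nonzero by simp
qed

lemma right_separating:
  assumes "x \<in> carrier R" "\<And>p. p \<in> positions \<Longrightarrow> x \<otimes> u p = \<zero>"
  shows "x = \<zero>"
proof -
  have "x = x \<otimes> (\<Oplus>p\<in>positions. u p)" using assms(1) e_sum by simp
  also have "\<dots> = (\<Oplus>p\<in>positions. x \<otimes> u p)"
    by (rule finsum_rdistr[OF finite_positions assms(1)]) (use u_closed in blast)
  also have "\<dots> = \<zero>" using assms(2) by (rule add.finprod_one_eqI)
  finally show ?thesis .
qed

lemma left_separating:
  assumes "x \<in> carrier R" "\<And>p. p \<in> positions \<Longrightarrow> u p \<otimes> x = \<zero>"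
  shows "x = \<zero>"
proof -
  have "x = (\<Oplus>p\<in>positions. u p) \<otimes> x" using assms(1) e_sum by simp
  also have "\<dots> = (\<Oplus>p\<in>positions. u p \<otimes> x)"
    by (rule finsum_ldistr[OF finite_positions assms(1)]) (use u_closed in blast)
  also have "\<dots> = \<zero>" using assms(2) by (rule add.finprod_one_eqI)
  finally show ?thesis .
qed

text \<open>Both outer units factor through the corners \<open>e i 0 0\<close> and
  \<open>e i' 0 0\<close>, where \<open>simple_blocks\<close> applies.\<close>

lemma blocks_orth:
  assumes "simple_blocks R I e" "i \<in> I" "i' \<in> I" "i \<noteq> i'" "x \<in> carrier R"
    and "j < m i" "k < m i" "j' < m i'" "k' < m i'"
  shows "e i j k \<otimes> x \<otimes> e i' j' k' = \<zero>"
proof -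
  note c = e_closed[OF assms(2)] e_closed[OF assms(3)] m_pos[OF assms(2)] m_pos[OF assms(3)]
  have "e i j k \<otimes> x \<otimes> e i' j' k' =
      e i j 0 \<otimes> (e i 0 0 \<otimes> (e i 0 k \<otimes> x \<otimes> e i' j' 0) \<otimes> e i' 0 0) \<otimes> e i' 0 k'"
    using assms c by (simp add: m_assoc e_mult_same_assoc e_mult_same)
  also have "\<dots> = \<zero>"
    using assms c by (simp add: simple_blocks_def)
  finally show ?thesis .
qed

text \<open>The left ideal \<open>R u p\<close> is simple.\<close>
definition simple_position :: "'i \<times> nat \<Rightarrow> bool" where
  "simple_position p \<longleftrightarrow>
     (\<forall>x\<in>carrier R. x \<otimes> u p \<noteq> \<zero> \<longrightarrow> (\<exists>r\<in>carrier R. r \<otimes> (x \<otimes> u p) = u p))"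

text \<open>A nonzero \<open>x \<otimes> u p\<close> has a nonzero component under some
  \<open>u q\<close>, and orthogonality puts \<open>q\<close> in the block of \<open>p\<close>.
  Matrix units carry this component to the corner, where it can be inverted, and carry the inverse
  back.\<close>

lemma simple_position_of_simple_blocks:
  assumes "simple_blocks R I e" "p \<in> positions"
  shows "simple_position p"
  unfolding simple_position_def
proof (intro ballI impI)
  fix x assume x: "x \<in> carrier R" "x \<otimes> u p \<noteq> \<zero>"
  obtain i j where p: "p = (i, j)" "i \<in> I" "j < m i" using assms(2) by auto
  then have xu: "x \<otimes> e i j j \<in> carrier R" using x e_closed by simp
  moreover have "x \<otimes> e i j j \<noteq> \<zero>" using x(2) p(1) by simp
  ultimately obtain q where "q \<in> positions" "u q \<otimes> (x \<otimes> e i j j) \<noteq> \<zero>"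
    using left_separating by blast
  then obtain i' k where q: "i' \<in> I" "k < m i'" "e i' k k \<otimes> (x \<otimes> e i j j) \<noteq> \<zero>" by auto
  have "i' = i"
  proof (rule ccontr)
    assume "i' \<noteq> i"
    then have "e i' k k \<otimes> x \<otimes> e i j j = \<zero>"
      using blocks_orth[OF assms(1)] q p x(1) by blast
    then show False
      using q p x(1) e_closed[OF q(1)] e_closed[OF p(2)] by (simp add: m_assoc)
  qed
  then have k: "k < m i" "e i k k \<otimes> (x \<otimes> e i j j) \<noteq> \<zero>" using q by auto
  note c = e_closed[OF p(2)] m_pos[OF p(2)]
  \<comment> \<open>The component at row \<open>k\<close> and column \<open>j\<close>, moved to the
    corner.\<close>
  let ?z = "e i 0 k \<otimes> x \<otimes> e i j 0"
  have z: "e i 0 0 \<otimes> ?z \<otimes> e i 0 0 = ?z"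
    using x p k c by (simp add: m_assoc e_mult_same_assoc e_mult_same)
  have "e i k k \<otimes> (x \<otimes> e i j j) = e i k 0 \<otimes> ?z \<otimes> e i 0 j"
    using x p k c by (simp add: m_assoc e_mult_same_assoc e_mult_same)
  then have "?z \<noteq> \<zero>" using k(2) p c k(1) by auto
  moreover have zc: "?z \<in> carrier R" using x p k c by simp
  ultimately have "e i 0 0 \<otimes> ?z \<otimes> e i 0 0 \<noteq> \<zero>" using z by argo
  then have "\<exists>y\<in>carrier R. y \<otimes> (e i 0 0 \<otimes> ?z \<otimes> e i 0 0) = e i 0 0"
    using assms(1) p(2) zc unfolding simple_blocks_def by blast
  then obtain y where y: "y \<in> carrier R" "y \<otimes> ?z = e i 0 0"
    unfolding z by blast
  have "e i j 0 \<otimes> y \<otimes> e i 0 k \<otimes> (x \<otimes> e i j j) = e i j 0 \<otimes> (y \<otimes> ?z) \<otimes> e i 0 j"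
    using x p k c y(1) by (simp add: m_assoc e_mult_same_assoc e_mult_same)
  also have "\<dots> = e i j j" using y p c by (simp add: e_mult_same)
  finally show "\<exists>r\<in>carrier R. r \<otimes> (x \<otimes> u p) = u p"
    using x p k c y by (intro bexI[of _ "e i j 0 \<otimes> y \<otimes> e i 0 k"]) auto
qed

lemma left_ideal_annihilator:
  assumes "Q \<subseteq> positions"
  shows "left_ideal {x \<in> carrier R. \<forall>p\<in>Q. x \<otimes> u p = \<zero>} R"
proof -
  have "u p \<in> carrier R" if "p \<in> Q" for p using assms that u_closed by blast
  then show ?thesis by (auto simp: left_ideal_iff l_distr m_assoc)
qed

text \<open>The quotient by the annihilator of \<open>u p\<close> is a copy of the simple left ideal
  generated by \<open>u p\<close>, and the annihilators meet in zero. The quantifier over a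
  singleton matches the shape of \<open>left_ideal_annihilator\<close>.\<close>

lemma left_length_le_of_simple_blocks:
  assumes "simple_blocks R I e"
  shows "left_length_le R (card positions)"
proof (rule left_length_le_of_cosimple[OF finite_positions,
      of "\<lambda>p. {x \<in> carrier R. \<forall>p\<in>{p}. x \<otimes> u p = \<zero>}"])
  show "left_ideal {x \<in> carrier R. \<forall>p\<in>{p}. x \<otimes> u p = \<zero>} R" if "p \<in> positions" for p
    using left_ideal_annihilator[of "{p}"] that by blast
  show "x = \<zero>"
    if "x \<in> carrier R" "\<And>p. p \<in> positions \<Longrightarrow> x \<in> {x \<in> carrier R. \<forall>p\<in>{p}. x \<otimes> u p = \<zero>}" for x
    using right_separating that by auto
  fix p x y
  assume p: "p \<in> positions" and x: "x \<in> carrier R" and y: "y \<in> carrier R"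
    and "x \<notin> {x \<in> carrier R. \<forall>p\<in>{p}. x \<otimes> u p = \<zero>}"
  then have "x \<otimes> u p \<noteq> \<zero>" by blast
  then obtain r where r: "r \<in> carrier R" "r \<otimes> (x \<otimes> u p) = u p"
    using simple_position_of_simple_blocks[OF assms p] x unfolding simple_position_def by blast
  note c = u_closed[OF p]
  \<comment> \<open>Since \<open>r\<close> takes \<open>x \<otimes> u p\<close> to
    \<open>u p\<close>, the multiplier \<open>y \<otimes> u p \<otimes> r\<close> takes it to
    \<open>y \<otimes> u p\<close>, as the difference requires.\<close>
  have "(y \<ominus> (y \<otimes> u p \<otimes> r) \<otimes> x) \<otimes> u p = y \<otimes> u p \<ominus> y \<otimes> u p \<otimes> (r \<otimes> (x \<otimes> u p))"
    using c x y r(1) by (simp add: a_minus_def l_distr l_minus m_assoc)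
  also have "\<dots> = \<zero>" using c x y r u_idem[OF p] by (simp add: m_assoc)
  finally show "\<exists>r\<in>carrier R. y \<ominus> r \<otimes> x \<in> {x \<in> carrier R. \<forall>p\<in>{p}. x \<otimes> u p = \<zero>}"
    using c x y r by (intro bexI[of _ "y \<otimes> u p \<otimes> r"]) auto
qed

text \<open>If \<open>R u p\<close> were not simple, the chain of annihilators of sets of positions could be refined
  above the annihilator of \<open>u p\<close>.\<close>
lemma simple_position_of_left_length_le:
  assumes "left_length_le R (card positions)" "p \<in> positions"
  shows "simple_position p"
  unfolding simple_position_def
proof (intro ballI impI, rule ccontr)
  fix x assume x: "x \<in> carrier R" "x \<otimes> u p \<noteq> \<zero>"
    and none: "\<not> (\<exists>r\<in>carrier R. r \<otimes> (x \<otimes> u p) = u p)"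
  obtain len :: "'a set \<Rightarrow> nat" where len: "\<And>L. left_ideal L R \<Longrightarrow> len L \<le> card positions"
      "\<And>L L'. \<lbrakk>left_ideal L R; left_ideal L' R; L \<subset> L'\<rbrakk> \<Longrightarrow> len L < len L'"
    using assms(1) unfolding left_length_le_def by blast
  define G where "G Q = {x \<in> carrier R. \<forall>q\<in>positions - Q. x \<otimes> u q = \<zero>}" for Q
  have G: "left_ideal (G Q) R" for Q
    unfolding G_def by (rule left_ideal_annihilator) blast
  \<comment> \<open>Each position added to \<open>Q\<close> removes one annihilation condition, and
    the matching \<open>u q\<close> enters: the rank rises by at least one.\<close>
  have card_le: "card Q \<le> len (G Q)" if "finite Q" "Q \<subseteq> positions" for Q
    using that
  proof (induction Q)
    case (insert q Q)
    have qp: "q \<in> positions" using insert.prems by blast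
    have "u q \<otimes> u p = \<zero>" if "p \<in> positions - insert q Q" for p
      by (rule u_orth) (use qp that in auto)
    then have uG: "u q \<in> G (insert q Q)" unfolding G_def using u_closed[OF qp] by simp
    have "u q \<otimes> u q \<noteq> \<zero>" unfolding u_idem[OF qp] by (rule u_nonzero[OF qp])
    then have "u q \<notin> G Q" unfolding G_def using insert.hyps insert.prems by blast
    moreover have "G Q \<subseteq> G (insert q Q)" unfolding G_def by blast
    ultimately have "G Q \<subset> G (insert q Q)" using uG by blast
    then have "len (G Q) < len (G (insert q Q))" by (rule len(2)[OF G G])
    then show ?case using insert by simp
  qed simp
  \<comment> \<open>The preimage of the left ideal generated by \<open>x \<otimes> u p\<close> under
    right multiplication by \<open>u p\<close>. It contains \<open>x\<close>, which does not
    annihilate \<open>u p\<close>, and misses \<open>u p\<close> itself, so it lies strictly between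
    the annihilator of \<open>u p\<close> and the ring.\<close>
  let ?H = "{y \<in> carrier R. \<exists>r\<in>carrier R. y \<otimes> u p = r \<otimes> (x \<otimes> u p)}"
  note c = u_closed[OF assms(2)]
  have H: "left_ideal ?H R"
    unfolding left_ideal_iff
  proof (intro conjI ballI)
    show "\<zero> \<in> ?H" using c x by (auto intro!: bexI[of _ \<zero>])
    fix y z assume "y \<in> ?H" "z \<in> ?H"
    then obtain r s where *: "r \<in> carrier R" "s \<in> carrier R" "y \<in> carrier R" "z \<in> carrier R"
      "y \<otimes> u p = r \<otimes> (x \<otimes> u p)" "z \<otimes> u p = s \<otimes> (x \<otimes> u p)" by blast
    then have "(y \<oplus> z) \<otimes> u p = (r \<oplus> s) \<otimes> (x \<otimes> u p)" using c x by (simp add: l_distr)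
    then show "y \<oplus> z \<in> ?H" using * by blast
  next
    fix t y assume t: "t \<in> carrier R" and "y \<in> ?H"
    then obtain r where *: "r \<in> carrier R" "y \<in> carrier R" "y \<otimes> u p = r \<otimes> (x \<otimes> u p)" by blast
    then have "(t \<otimes> y) \<otimes> u p = (t \<otimes> r) \<otimes> (x \<otimes> u p)" using c x t by (simp add: m_assoc)
    then show "t \<otimes> y \<in> ?H" using * t by blast
  qed blast
  have GH: "G (positions - {p}) \<subset> ?H"
  proof
    show "G (positions - {p}) \<subseteq> ?H"
    proof
      fix y assume "y \<in> G (positions - {p})"
      then have "y \<in> carrier R" "y \<otimes> u p = \<zero>" unfolding G_def using assms(2) by blast+
      then show "y \<in> ?H" using c x by (auto intro!: bexI[of _ \<zero>])
    qed
    have "x \<in> ?H" using x c by (auto intro!: bexI[of _ \<one>])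
    moreover have "x \<notin> G (positions - {p})" unfolding G_def using assms(2) x by blast
    ultimately show "G (positions - {p}) \<noteq> ?H" by blast
  qed
  have "u p \<notin> ?H" using none u_idem[OF assms(2)] by auto
  then have "?H \<subset> carrier R" using c by blast
  then have "len ?H < len (carrier R)" using len(2)[OF H left_ideal_carrier] by blast
  moreover have "len (G (positions - {p})) < len ?H" using len(2)[OF G H GH] .
  moreover have "card (positions - {p}) \<le> len (G (positions - {p}))"
    using card_le finite_positions by blast
  moreover have "len (carrier R) \<le> card positions" using len(1)[OF left_ideal_carrier] .
  moreover have "card positions = Suc (card (positions - {p}))"
    using finite_positions assms(2) by (simp only: card.remove)
  \<comment> \<open>Rank at least card - 1 below, two strict increases, and at most card at the
    top.\<close>
  ultimately show False by linarith
qed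

text \<open>Exactly one block of the family \<open>e\<close> fails to annihilate the simple left ideal
  \<open>R g i 0 0\<close>; the resulting map between the sets of blocks is onto, hence injective.\<close>
lemma simple_blocks_of_simple_blocks:
  assumes "simple_blocks R I e" and "matrix_units R I m g"
  shows "simple_blocks R I g"
proof -
  interpret G: matrix_units R I m g by fact
  have simp: "G.simple_position p" if "p \<in> positions" for p
    using G.simple_position_of_left_length_le[OF left_length_le_of_simple_blocks[OF assms(1)] that] .
  have simp0: "\<exists>r\<in>carrier R. r \<otimes> (x \<otimes> g i 0 0) = g i 0 0"
    if "i \<in> I" "x \<in> carrier R" "x \<otimes> g i 0 0 \<noteq> \<zero>" for i x
    using simp[of "(i, 0)"] that m_pos unfolding G.simple_position_def by auto
  have c: "e i 0 0 \<in> carrier R" "g i 0 0 \<in> carrier R" if "i \<in> I" for i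
    using that m_pos e_closed G.e_closed by auto
  \<comment> \<open>A nonzero homomorphism between the simple left ideals of \<open>e k 0 0\<close>
    and \<open>g i 0 0\<close>, that is, an isomorphism.\<close>
  define hits where "hits k i \<longleftrightarrow> (\<exists>a\<in>carrier R. e k 0 0 \<otimes> a \<otimes> g i 0 0 \<noteq> \<zero>)" for k i
  \<comment> \<open>Simplicity writes each corner of \<open>g\<close> as a multiple passing through
    the block of \<open>e\<close> that it meets. Substituting both, the product contains an element
    of one block of \<open>e\<close> multiplied into another, which is zero unless the blocks
    coincide.\<close>
  have link: "k = k'"
    if ki: "hits k i" "hits k' i'" "k \<in> I" "k' \<in> I" "i \<in> I" "i' \<in> I" "x \<in> carrier R"
      "g i' 0 0 \<otimes> x \<otimes> g i 0 0 \<noteq> \<zero>" for k k' i i' x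
  proof (rule ccontr)
    assume "k \<noteq> k'"
    obtain a where a: "a \<in> carrier R" "e k 0 0 \<otimes> a \<otimes> g i 0 0 \<noteq> \<zero>" using ki hits_def by auto
    obtain b where b: "b \<in> carrier R" "e k' 0 0 \<otimes> b \<otimes> g i' 0 0 \<noteq> \<zero>" using ki hits_def by auto
    obtain r where r: "r \<in> carrier R" "r \<otimes> (e k 0 0 \<otimes> a \<otimes> g i 0 0) = g i 0 0"
      using simp0[of i "e k 0 0 \<otimes> a"] a ki c by auto
    obtain s where s: "s \<in> carrier R" "s \<otimes> (e k' 0 0 \<otimes> b \<otimes> g i' 0 0) = g i' 0 0"
      using simp0[of i' "e k' 0 0 \<otimes> b"] b ki c by auto
    have "g i' 0 0 \<otimes> x \<otimes> g i 0 0 =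
        s \<otimes> (e k' 0 0 \<otimes> b \<otimes> g i' 0 0) \<otimes> x \<otimes> (r \<otimes> (e k 0 0 \<otimes> a \<otimes> g i 0 0))"
      using r s by simp
    also have "\<dots> = s \<otimes> (e k' 0 0 \<otimes> (b \<otimes> g i' 0 0 \<otimes> x \<otimes> r) \<otimes> e k 0 0) \<otimes> (a \<otimes> g i 0 0)"
      using a(1) b(1) r(1) s(1) ki c by (simp add: m_assoc)
    also have "e k' 0 0 \<otimes> (b \<otimes> g i' 0 0 \<otimes> x \<otimes> r) \<otimes> e k 0 0 = \<zero>"
      using assms(1) \<open>k \<noteq> k'\<close> ki c b(1) r(1) unfolding simple_blocks_def by (metis m_closed)
    finally show False using ki a s c by simp
  qed
  have ex: "\<exists>k\<in>I. hits k i" if i: "i \<in> I" for i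
  proof -
    obtain q where "q \<in> positions" "u q \<otimes> g i 0 0 \<noteq> \<zero>"
      using left_separating[OF c(2)[OF i]] G.e_nonzero[OF i] by blast
    then obtain k j where k: "k \<in> I" "j < m k" "e k j j \<otimes> g i 0 0 \<noteq> \<zero>" by auto
    have "e k j j \<otimes> g i 0 0 = e k j 0 \<otimes> (e k 0 0 \<otimes> e k 0 j \<otimes> g i 0 0)"
      using k c i m_pos[OF k(1)] e_closed[OF k(1)]
      by (simp add: m_assoc e_mult_same_assoc e_mult_same)
    then have "e k 0 0 \<otimes> e k 0 j \<otimes> g i 0 0 \<noteq> \<zero>"
      using k m_pos[OF k(1)] e_closed[OF k(1)] by auto
    then show ?thesis unfolding hits_def using k m_pos[OF k(1)] e_closed[OF k(1)] by blast
  qed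
  then obtain f where f: "\<And>i. i \<in> I \<Longrightarrow> f i \<in> I \<and> hits (f i) i" by metis
  have self: "g i 0 0 \<otimes> \<one> \<otimes> g i 0 0 \<noteq> \<zero>" if "i \<in> I" for i
    using that c m_pos G.e_mult_same G.e_nonzero by simp
  \<comment> \<open>Every \<open>e k 0 0\<close> is nonzero, so it meets some block of
    \<open>g\<close>; \<open>link\<close> with \<open>i' = i\<close> and \<open>x = \<one>\<close>
    identifies \<open>k\<close> as the value of \<open>f\<close> there. As \<open>f\<close> maps the
    finite set \<open>I\<close> into itself, it is injective.\<close>
  have "I \<subseteq> f ` I"
  proof
    fix k assume k: "k \<in> I"
    obtain q where "q \<in> positions" "e k 0 0 \<otimes> G.u q \<noteq> \<zero>"
      using G.right_separating[OF c(1)[OF k]] e_nonzero[OF k] by blast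
    then obtain i j where i: "i \<in> I" "j < m i" "e k 0 0 \<otimes> g i j j \<noteq> \<zero>" by auto
    have "e k 0 0 \<otimes> g i j j = (e k 0 0 \<otimes> g i j 0 \<otimes> g i 0 0) \<otimes> g i 0 j"
      using k c i m_pos[OF i(1)] G.e_closed[OF i(1)]
      by (simp add: m_assoc G.e_mult_same_assoc G.e_mult_same)
    then have "e k 0 0 \<otimes> g i j 0 \<otimes> g i 0 0 \<noteq> \<zero>"
      using i m_pos[OF i(1)] G.e_closed[OF i(1)] by auto
    then have "hits k i" unfolding hits_def using i m_pos[OF i(1)] G.e_closed[OF i(1)] by blast
    then have "k = f i" using link[of k i "f i" i \<one>] k i f self by blast
    then show "k \<in> f ` I" using i by blast
  qed
  then have inj: "inj_on f I"
    using finite_I finite_surj_inj[of I f] by (metis card_image_le card_mono eq_card_imp_inj_on finite_imageI le_antisym)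
  show ?thesis
    unfolding simple_blocks_def
  proof (intro conjI ballI impI)
    fix i i' x assume *: "i \<in> I" "i' \<in> I" "x \<in> carrier R" "i \<noteq> i'"
    \<comment> \<open>A nonzero product would link the two blocks and give them the same value under
      \<open>f\<close>.\<close>
    then show "g i 0 0 \<otimes> x \<otimes> g i' 0 0 = \<zero>"
      using link[of "f i'" i' "f i" i x] f inj by (metis inj_onD)
  next
    fix i x assume *: "i \<in> I" "x \<in> carrier R" "g i 0 0 \<otimes> x \<otimes> g i 0 0 \<noteq> \<zero>"
    then show "\<exists>y\<in>carrier R. y \<otimes> (g i 0 0 \<otimes> x \<otimes> g i 0 0) = g i 0 0"
      using simp0[of i "g i 0 0 \<otimes> x"] c by simp
  qed
qed

end

text \<open>Nonvanishing of the corners is the one clause that a ring homomorphism can destroy; the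
  others are identities.\<close>

lemma matrix_units_hom:
  assumes "matrix_units R I m e" "ring S" "h \<in> ring_hom R S"
    and "\<And>i. i \<in> I \<Longrightarrow> h (e i 0 0) \<noteq> \<zero>\<^bsub>S\<^esub>"
  shows "matrix_units S I m (\<lambda>i j k. h (e i j k))"
proof -
  interpret R: matrix_units R I m e by fact
  interpret S: ring S by fact
  interpret h: ring_hom_ring R S h
    using R.ring_axioms assms(2,3) by (simp add: ring_hom_ringI2)
  show ?thesis
  proof
    show "finite I" by (rule R.finite_I)
    show "0 < m i" if "i \<in> I" for i using R.m_pos that .
    show "h (e i j k) \<in> carrier S" if "i \<in> I" "j < m i" "k < m i" for i j k
      using R.e_closed that by simp
    show "h (e i j k) \<otimes>\<^bsub>S\<^esub> h (e i k l) = h (e i j l)"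
      if "i \<in> I" "j < m i" "k < m i" "l < m i" for i j k l
      using R.e_closed R.e_mult_same that by (simp flip: h.hom_mult)
    show "h (e i j k) \<otimes>\<^bsub>S\<^esub> h (e i' j' k') = \<zero>\<^bsub>S\<^esub>"
      if "i \<in> I" "j < m i" "k < m i" "i' \<in> I" "j' < m i'" "k' < m i'" "i \<noteq> i' \<or> k \<noteq> j'"
      for i j k i' j' k'
      using R.e_closed R.e_mult_diff[OF that] that by (simp flip: h.hom_mult)
    show "h (e i 0 0) \<noteq> \<zero>\<^bsub>S\<^esub>" if "i \<in> I" for i using assms(4) that .
    have "h (\<Oplus>\<^bsub>R\<^esub>p\<in>R.positions. R.u p) = finsum S (h \<circ> R.u) R.positions"
      by (rule h.hom_finsum) (use R.u_closed in blast)
    then show "(\<Oplus>\<^bsub>S\<^esub>p\<in>R.positions. h (R.u p)) = \<one>\<^bsub>S\<^esub>"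
      by (simp add: R.e_sum comp_def)
  qed
qed

subsection \<open>Decomposition along matrix units\<close>

context absorbing_extension
begin

lemma matrix_units_restrict:
  assumes "matrix_units A I m g"
    and g: "\<And>i j k. \<lbrakk>i \<in> I; j < m i; k < m i\<rbrakk> \<Longrightarrow> g i j k \<in> carrier R"
  shows "matrix_units R I m g"
proof -
  interpret G: matrix_units A I m g by fact
  interpret h: ring_hom_ring R A "\<lambda>x. x"
    by (rule ring_hom_ringI2[OF ring_R ring_A incl])
  show ?thesis
  proof
    show "g i j k \<otimes>\<^bsub>R\<^esub> g i k l = g i j l"
      if "i \<in> I" "j < m i" "k < m i" "l < m i" for i j k l
      using g G.e_mult_same that by (simp add: mult_eq)
    show "g i j k \<otimes>\<^bsub>R\<^esub> g i' j' k' = \<zero>\<^bsub>R\<^esub>"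
      if "i \<in> I" "j < m i" "k < m i" "i' \<in> I" "j' < m i'" "k' < m i'" "i \<noteq> i' \<or> k \<noteq> j'"
      for i j k i' j' k'
      using g G.e_mult_diff[OF that] that by (simp add: mult_eq zero_eq)
    have "finsum R G.u G.positions = finsum A ((\<lambda>x. x) \<circ> G.u) G.positions"
      by (rule h.hom_finsum) (use g in auto)
    then show "finsum R G.u G.positions = \<one>\<^bsub>R\<^esub>"
      by (simp add: G.e_sum comp_def one_eq)
  qed (use g G.finite_I G.m_pos G.e_nonzero in \<open>auto simp: zero_eq\<close>)
qed

lemma matrix_units_extension:
  assumes "matrix_units R I m e"
  shows "matrix_units A I m e"
proof -
  interpret E: matrix_units R I m e by fact
  show ?thesis
    using matrix_units_hom[OF assms ring_A incl] E.e_nonzero by (simp add: zero_eq)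
qed

text \<open>Each clause involves one \<open>x\<close> and finitely many units, so some
  \<open>T l\<close> moves all of them into \<open>R\<close>. The transported units need not be the
  original ones, but they have the same shape, and the comparison within \<open>R\<close> gives them
  simple blocks. The power is chosen anew for each \<open>x\<close>.\<close>

lemma simple_blocks_extension:
  assumes mu: "matrix_units R I m e" and sb: "simple_blocks R I e"
  shows "simple_blocks A I e"
proof -
  interpret E: matrix_units R I m e by fact
  interpret EA: matrix_units A I m e by (rule matrix_units_extension[OF mu])
  have e0: "e i 0 0 \<in> carrier A" if "i \<in> I" for i using EA.e_closed EA.m_pos that by blast
  have shift: "\<exists>l. T l x \<in> carrier R \<and> simple_blocks R I (\<lambda>i j k. T l (e i j k)) \<and>
      (\<forall>i\<in>I. T l (e i 0 0) \<in> carrier R)"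
    if x: "x \<in> carrier A" for x
  proof -
    let ?Q = "insert x ((\<lambda>(i, j, k). e i j k) ` (SIGMA i:I. {..<m i} \<times> {..<m i}))"
    have "finite ?Q" using E.finite_I by simp
    moreover have "?Q \<subseteq> carrier A" using x EA.e_closed by auto
    ultimately obtain l where l: "\<forall>y\<in>?Q. T l y \<in> carrier R" using absorb by blast
    have closed: "T l (e i j k) \<in> carrier R" if "i \<in> I" "j < m i" "k < m i" for i j k
    proof -
      have "(i, j, k) \<in> (SIGMA i:I. {..<m i} \<times> {..<m i})" using that by simp
      then have "e i j k \<in> ?Q" by force
      then show ?thesis using l by blast
    qed
    have "matrix_units A I m (\<lambda>i j k. T l (e i j k))"
      by (rule matrix_units_hom[OF EA.matrix_units_axioms ring_A T_hom])
        (use T_eq_zero_iff e0 EA.e_nonzero in blast)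
    then have "matrix_units R I m (\<lambda>i j k. T l (e i j k))"
      by (rule matrix_units_restrict) (rule closed)
    then have "simple_blocks R I (\<lambda>i j k. T l (e i j k))"
      by (rule E.simple_blocks_of_simple_blocks[OF sb])
    moreover have "T l (e i 0 0) \<in> carrier R" if "i \<in> I" for i
      using closed that E.m_pos by blast
    ultimately show ?thesis using l by blast
  qed
  show ?thesis
    unfolding simple_blocks_def
  proof (intro conjI ballI impI)
    fix i i' x assume *: "i \<in> I" "i' \<in> I" "x \<in> carrier A" "i \<noteq> i'"
    obtain l where l: "T l x \<in> carrier R" "simple_blocks R I (\<lambda>i j k. T l (e i j k))"
        "\<forall>i\<in>I. T l (e i 0 0) \<in> carrier R"
      using shift[OF *(3)] by blast
    have "T l (e i 0 0) \<otimes>\<^bsub>R\<^esub> T l x \<otimes>\<^bsub>R\<^esub> T l (e i' 0 0) = \<zero>\<^bsub>R\<^esub>"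
      using l * unfolding simple_blocks_def by blast
    moreover have "T l (e i 0 0) \<otimes>\<^bsub>R\<^esub> T l x \<in> carrier R" using l * by simp
    ultimately have "T l (e i 0 0 \<otimes>\<^bsub>A\<^esub> x \<otimes>\<^bsub>A\<^esub> e i' 0 0) = \<zero>\<^bsub>A\<^esub>"
      using l * e0 by (simp add: T_mult mult_eq zero_eq)
    then show "e i 0 0 \<otimes>\<^bsub>A\<^esub> x \<otimes>\<^bsub>A\<^esub> e i' 0 0 = \<zero>\<^bsub>A\<^esub>"
      using T_eq_zero_iff * e0 by simp
  next
    fix i x assume *: "i \<in> I" "x \<in> carrier A" "e i 0 0 \<otimes>\<^bsub>A\<^esub> x \<otimes>\<^bsub>A\<^esub> e i 0 0 \<noteq> \<zero>\<^bsub>A\<^esub>"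
    obtain l where l: "T l x \<in> carrier R" "simple_blocks R I (\<lambda>i j k. T l (e i j k))"
        "\<forall>i\<in>I. T l (e i 0 0) \<in> carrier R"
      using shift[OF *(2)] by blast
    let ?g = "T l (e i 0 0)"
    have g: "?g \<in> carrier R" using l * by blast
    have gx: "?g \<otimes>\<^bsub>R\<^esub> T l x \<in> carrier R" using l g by simp
    have eq: "?g \<otimes>\<^bsub>R\<^esub> T l x \<otimes>\<^bsub>R\<^esub> ?g = T l (e i 0 0 \<otimes>\<^bsub>A\<^esub> x \<otimes>\<^bsub>A\<^esub> e i 0 0)"
      using l(1) g gx * e0 by (simp add: T_mult mult_eq)
    then have "?g \<otimes>\<^bsub>R\<^esub> T l x \<otimes>\<^bsub>R\<^esub> ?g \<noteq> \<zero>\<^bsub>R\<^esub>"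
      using T_eq_zero_iff * e0 by (simp add: zero_eq)
    then obtain y where y: "y \<in> carrier R" "y \<otimes>\<^bsub>R\<^esub> (?g \<otimes>\<^bsub>R\<^esub> T l x \<otimes>\<^bsub>R\<^esub> ?g) = ?g"
      using l * unfolding simple_blocks_def by blast
    \<comment> \<open>The inverse found in \<open>R\<close> is pulled back along the automorphism;
      its preimage lies in \<open>A\<close> and possibly outside \<open>R\<close>.\<close>
    obtain z where z: "z \<in> carrier A" "T l z = y" using T_surj[OF carrier_sub[OF y(1)]] .
    have "?g \<otimes>\<^bsub>R\<^esub> T l x \<otimes>\<^bsub>R\<^esub> ?g \<in> carrier R" using gx g by simp
    then have "y \<otimes>\<^bsub>A\<^esub> T l (e i 0 0 \<otimes>\<^bsub>A\<^esub> x \<otimes>\<^bsub>A\<^esub> e i 0 0) = ?g"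
      using y mult_eq eq by metis
    then have "T l (z \<otimes>\<^bsub>A\<^esub> (e i 0 0 \<otimes>\<^bsub>A\<^esub> x \<otimes>\<^bsub>A\<^esub> e i 0 0)) = ?g"
      using z * e0 by (simp add: T_mult)
    then have "z \<otimes>\<^bsub>A\<^esub> (e i 0 0 \<otimes>\<^bsub>A\<^esub> x \<otimes>\<^bsub>A\<^esub> e i 0 0) = e i 0 0"
      by (rule T_inj[rotated 2]) (use z * e0 in simp_all)
    then show "\<exists>y\<in>carrier A. y \<otimes>\<^bsub>A\<^esub> (e i 0 0 \<otimes>\<^bsub>A\<^esub> x \<otimes>\<^bsub>A\<^esub> e i 0 0) = e i 0 0"
      using z by blast
  qed
qed

end

section \<open>Corner rings and the Peirce decomposition\<close>

context matrix_units
begin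

text \<open>The Peirce corner e R e for \<open>e = e i 0 0\<close>, whose unity is that idempotent.
  Describing it by fixed elements turns membership into two equations. Taken in \<open>A\<close>,
  these rings are the division rings of the decomposition.\<close>

definition corner_ring :: "'i \<Rightarrow> 'a ring" where
  "corner_ring i =
    \<lparr>carrier = {x \<in> carrier R. e i 0 0 \<otimes> x = x \<and> x \<otimes> e i 0 0 = x},
     monoid.mult = (\<otimes>), monoid.one = e i 0 0, ring.zero = \<zero>, ring.add = (\<oplus>)\<rparr>"

lemma corner_ring_simps [simp]:
  "carrier (corner_ring i) = {x \<in> carrier R. e i 0 0 \<otimes> x = x \<and> x \<otimes> e i 0 0 = x}"
  "x \<otimes>\<^bsub>corner_ring i\<^esub> y = x \<otimes> y"
  "\<one>\<^bsub>corner_ring i\<^esub> = e i 0 0"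
  "\<zero>\<^bsub>corner_ring i\<^esub> = \<zero>"
  "x \<oplus>\<^bsub>corner_ring i\<^esub> y = x \<oplus> y"
  by (simp_all add: corner_ring_def)

lemma e00:
  assumes "i \<in> I"
  shows "e i 0 0 \<in> carrier R" "e i 0 0 \<otimes> e i 0 0 = e i 0 0"
  using assms m_pos e_closed e_mult_same by auto

lemma ring_corner_ring:
  assumes "i \<in> I"
  shows "ring (corner_ring i)"
proof (rule ringI)
  note c = e00[OF assms]
  show "abelian_group (corner_ring i)"
  proof (rule abelian_groupI)
    fix x assume x: "x \<in> carrier (corner_ring i)"
    then have "\<ominus> x \<in> carrier (corner_ring i)" using c by (simp add: r_minus l_minus)
    moreover have "\<ominus> x \<oplus>\<^bsub>corner_ring i\<^esub> x = \<zero>\<^bsub>corner_ring i\<^esub>" using x by (simp add: l_neg)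
    ultimately show "\<exists>y\<in>carrier (corner_ring i). y \<oplus>\<^bsub>corner_ring i\<^esub> x = \<zero>\<^bsub>corner_ring i\<^esub>" by blast
  qed (use c in \<open>auto simp: r_distr l_distr a_ac\<close>)
  show "Group.monoid (corner_ring i)"
  proof (rule monoidI)
    fix x y assume "x \<in> carrier (corner_ring i)" "y \<in> carrier (corner_ring i)"
    then show "x \<otimes>\<^bsub>corner_ring i\<^esub> y \<in> carrier (corner_ring i)"
      using c m_assoc[of "e i 0 0" x y] m_assoc[of x y "e i 0 0"] by simp
  qed (use c in \<open>auto simp: m_assoc\<close>)
qed (auto simp: l_distr r_distr)

text \<open>Left inverses of all nonzero elements suffice: a left inverse \<open>y\<close> of
  \<open>x\<close> has its own left inverse, which must equal \<open>x\<close>, so \<open>y\<close>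
  inverts \<open>x\<close> on both sides.\<close>

lemma skew_field_corner_ring:
  assumes "simple_blocks R I e" "i \<in> I"
  shows "skew_field (corner_ring i)"
proof -
  note c = e00[OF assms(2)]
  have left_inv: "\<exists>y\<in>carrier (corner_ring i). y \<otimes> x = e i 0 0"
    if x: "x \<in> carrier (corner_ring i)" "x \<noteq> \<zero>" for x
  proof -
    have xc: "x \<in> carrier R" "e i 0 0 \<otimes> x = x" "x \<otimes> e i 0 0 = x" using x by auto
    then have "e i 0 0 \<otimes> x \<otimes> e i 0 0 \<noteq> \<zero>" using x by simp
    then obtain y where "y \<in> carrier R" "y \<otimes> (e i 0 0 \<otimes> x \<otimes> e i 0 0) = e i 0 0"
      using assms xc(1) unfolding simple_blocks_def by blast
    then have y: "y \<in> carrier R" "y \<otimes> x = e i 0 0" using xc by auto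
    \<comment> \<open>The \<open>y\<close> from \<open>simple_blocks\<close> may lie anywhere in the
      ring; compressing it puts it into the corner and leaves its product with \<open>x\<close>
      unchanged.\<close>
    have "e i 0 0 \<otimes> y \<otimes> e i 0 0 \<in> carrier (corner_ring i)"
      using c y(1) m_assoc[of "e i 0 0" "e i 0 0" "y \<otimes> e i 0 0"] by (simp add: m_assoc)
    moreover have "e i 0 0 \<otimes> y \<otimes> e i 0 0 \<otimes> x = e i 0 0" using c y xc by (simp add: m_assoc)
    ultimately show ?thesis by blast
  qed
  have "Units (corner_ring i) = carrier (corner_ring i) - {\<zero>\<^bsub>corner_ring i\<^esub>}"
  proof
    show "Units (corner_ring i) \<subseteq> carrier (corner_ring i) - {\<zero>\<^bsub>corner_ring i\<^esub>}"
      using e_nonzero[OF assms(2)] by (auto simp: Units_def)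
    show "carrier (corner_ring i) - {\<zero>\<^bsub>corner_ring i\<^esub>} \<subseteq> Units (corner_ring i)"
    proof
      fix x assume "x \<in> carrier (corner_ring i) - {\<zero>\<^bsub>corner_ring i\<^esub>}"
      then have x: "x \<in> carrier (corner_ring i)" "x \<noteq> \<zero>" by auto
      then obtain y where y: "y \<in> carrier (corner_ring i)" "y \<otimes> x = e i 0 0" using left_inv by blast
      then have "y \<noteq> \<zero>" using x e_nonzero[OF assms(2)] by auto
      then obtain z where z: "z \<in> carrier (corner_ring i)" "z \<otimes> y = e i 0 0"
        using left_inv y by blast
      have "z = z \<otimes> (y \<otimes> x)" using y z by simp
      also have "\<dots> = x" using x y z m_assoc[of z y x] by simp
      finally have "x \<otimes> y = e i 0 0" using z by simp
      then show "x \<in> Units (corner_ring i)" using x y unfolding Units_def by auto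
    qed
  qed
  then show ?thesis
    using ring_corner_ring[OF assms(2)] by (simp add: skew_field_def skew_field_axioms_def)
qed

text \<open>Products in the matrix ring sum over the corner, while the Peirce identities are sums in
  the whole ring. The two rings share zero and addition.\<close>

lemma finsum_corner_ring:
  assumes "i \<in> I" "finite S" "f \<in> S \<rightarrow> carrier (corner_ring i)"
  shows "finsum (corner_ring i) f S = finsum R f S"
proof -
  interpret C: ring "corner_ring i" by (rule ring_corner_ring[OF assms(1)])
  show ?thesis
    using assms(2,3)
  proof (induction S)
    case empty
    show ?case using C.finsum_empty finsum_empty by simp
  next
    case (insert s S)
    then have f: "f \<in> S \<rightarrow> carrier (corner_ring i)" "f s \<in> carrier (corner_ring i)" by auto
    then have f': "f \<in> S \<rightarrow> carrier R" "f s \<in> carrier R" by auto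
    show ?case
      unfolding C.finsum_insert[OF insert.hyps f] finsum_insert[OF insert.hyps f']
        insert.IH[OF f(1)] by simp
  qed
qed

text \<open>The rule for matrix multiplication. Insert \<open>\<one>\<close> as the sum of the
  diagonal units between the factors: units of other blocks drop out by orthogonality, and
  \<open>e i l l\<close> splits as \<open>e i l 0 \<otimes> e i 0 l\<close>.\<close>

lemma block_sum:
  assumes "simple_blocks R I e" "i \<in> I" "j < m i" "k < m i" "a \<in> carrier R" "b \<in> carrier R"
  shows "e i 0 j \<otimes> (a \<otimes> b) \<otimes> e i k 0 =
    (\<Oplus>l\<in>{..<m i}. (e i 0 j \<otimes> a \<otimes> e i l 0) \<otimes> (e i 0 l \<otimes> b \<otimes> e i k 0))"
proof -
  note c = e_closed[OF assms(2)] m_pos[OF assms(2)]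
  let ?x = "e i 0 j \<otimes> a" and ?y = "b \<otimes> e i k 0"
  have xy: "?x \<in> carrier R" "?y \<in> carrier R" using assms c by auto
  have inj: "inj_on (Pair i) {..<m i}" by (simp add: inj_on_def)
  have "?x = ?x \<otimes> (\<Oplus>p\<in>positions. u p)" using xy e_sum by simp
  also have "\<dots> = (\<Oplus>p\<in>positions. ?x \<otimes> u p)"
    by (rule finsum_rdistr[OF finite_positions xy(1)]) (use u_closed in blast)
  also have "\<dots> = (\<Oplus>p\<in>Pair i ` {..<m i}. ?x \<otimes> u p)"
  proof (rule add.finprod_mono_neutral_cong_right)
    show "finite positions" by (rule finite_positions)
    show "Pair i ` {..<m i} \<subseteq> positions" using assms(2) by auto
    fix p assume "p \<in> positions - Pair i ` {..<m i}"
    then have "fst p \<in> I" "snd p < m (fst p)" "fst p \<noteq> i" by auto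
    then show "?x \<otimes> u p = \<zero>" using blocks_orth[OF assms(1,2)] assms c by metis
  qed (use xy u_closed in auto)
  also have "\<dots> = (\<Oplus>l\<in>{..<m i}. ?x \<otimes> e i l l)"
    using finsum_reindex[OF _ inj, of "\<lambda>p. ?x \<otimes> u p"] xy c by (auto simp: Pi_def)
  finally have expand: "?x = (\<Oplus>l\<in>{..<m i}. ?x \<otimes> e i l l)" .
  have "e i 0 j \<otimes> (a \<otimes> b) \<otimes> e i k 0 = ?x \<otimes> ?y" using assms c by (simp add: m_assoc)
  also have "\<dots> = (\<Oplus>l\<in>{..<m i}. ?x \<otimes> e i l l) \<otimes> ?y" using expand by simp
  also have "\<dots> = (\<Oplus>l\<in>{..<m i}. ?x \<otimes> e i l l \<otimes> ?y)"
    by (rule finsum_ldistr) (use xy c in auto)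
  also have "\<dots> = (\<Oplus>l\<in>{..<m i}. (?x \<otimes> e i l 0) \<otimes> (e i 0 l \<otimes> b \<otimes> e i k 0))"
  proof (rule finsum_cong')
    fix l assume "l \<in> {..<m i}"
    then show "?x \<otimes> e i l l \<otimes> ?y = (?x \<otimes> e i l 0) \<otimes> (e i 0 l \<otimes> b \<otimes> e i k 0)"
      using assms c by (simp add: m_assoc e_mult_same_assoc)
  qed (use assms c in auto)
  finally show ?thesis .
qed

text \<open>The entry at (j, k) is the Peirce component between \<open>e i j j\<close> and
  \<open>e i k k\<close>, carried to the common corner so that all entries of a block lie in one
  ring.\<close>

definition block_map :: "'a \<Rightarrow> 'i \<Rightarrow> nat \<times> nat \<Rightarrow> 'a" where
  "block_map a = (\<lambda>i\<in>I. \<lambda>(j, k)\<in>{..<m i} \<times> {..<m i}. e i 0 j \<otimes> a \<otimes> e i k 0)"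

lemma block_map_apply:
  "\<lbrakk>i \<in> I; j < m i; k < m i\<rbrakk> \<Longrightarrow> block_map a i (j, k) = e i 0 j \<otimes> a \<otimes> e i k 0"
  by (simp add: block_map_def)

lemma block_map_closed:
  assumes "i \<in> I" "j < m i" "k < m i" "a \<in> carrier R"
  shows "e i 0 j \<otimes> a \<otimes> e i k 0 \<in> carrier (corner_ring i)"
  using assms e_closed[OF assms(1)] m_pos[OF assms(1)]
  by (simp add: m_assoc e_mult_same_assoc e_mult_same)

abbreviation block_product :: "('i \<Rightarrow> nat \<times> nat \<Rightarrow> 'a) ring" where
  "block_product \<equiv> product_ring I (\<lambda>i. matrix_ring (m i) (corner_ring i))"

lemma block_map_hom:
  assumes "simple_blocks R I e"
  shows "block_map \<in> ring_hom R block_product"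
proof (rule ring_hom_memI)
  fix a assume a: "a \<in> carrier R"
  show "block_map a \<in> carrier block_product"
    unfolding product_ring_def matrix_ring_def block_map_def
    using block_map_closed[OF _ _ _ a] by (auto simp del: corner_ring_simps split: if_splits)
  fix b assume b: "b \<in> carrier R"
  show "block_map (a \<otimes> b) = block_map a \<otimes>\<^bsub>block_product\<^esub> block_map b"
  proof
    fix i
    show "block_map (a \<otimes> b) i = (block_map a \<otimes>\<^bsub>block_product\<^esub> block_map b) i"
    proof (cases "i \<in> I")
      case True
      note c = e_closed[OF True] m_pos[OF True]
      have "finsum (corner_ring i) (\<lambda>l. block_map a i (j, l) \<otimes> block_map b i (l, k)) {..<m i} =
          e i 0 j \<otimes> (a \<otimes> b) \<otimes> e i k 0" if jk: "j < m i" "k < m i" for j k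
      proof -
        interpret C: ring "corner_ring i" by (rule ring_corner_ring[OF True])
        have cl: "block_map a i (j, l) \<otimes> block_map b i (l, k) \<in> carrier (corner_ring i)"
          if "l < m i" for l
        proof -
          have "block_map a i (j, l) \<in> carrier (corner_ring i)"
            "block_map b i (l, k) \<in> carrier (corner_ring i)"
            using block_map_closed True jk that a b
            by (simp_all only: block_map_apply)
          from C.m_closed[OF this] show ?thesis by (simp only: corner_ring_simps(2))
        qed
        then have "finsum (corner_ring i) (\<lambda>l. block_map a i (j, l) \<otimes> block_map b i (l, k)) {..<m i}
            = (\<Oplus>l\<in>{..<m i}. block_map a i (j, l) \<otimes> block_map b i (l, k))"
          by (intro finsum_corner_ring[OF True]) auto
        also have "\<dots> = (\<Oplus>l\<in>{..<m i}. (e i 0 j \<otimes> a \<otimes> e i l 0) \<otimes> (e i 0 l \<otimes> b \<otimes> e i k 0))"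
          by (rule finsum_cong') (use True jk a b c in \<open>auto simp: block_map_apply\<close>)
        also have "\<dots> = e i 0 j \<otimes> (a \<otimes> b) \<otimes> e i k 0"
          using block_sum[OF assms True jk a b] by simp
        finally show ?thesis .
      qed
      then show ?thesis
        using True by (auto simp: product_ring_def matrix_ring_def block_map_def[of "a \<otimes> b"])
    qed (simp add: block_map_def product_ring_def)
  qed
  show "block_map (a \<oplus> b) = block_map a \<oplus>\<^bsub>block_product\<^esub> block_map b"
  proof
    fix i
    show "block_map (a \<oplus> b) i = (block_map a \<oplus>\<^bsub>block_product\<^esub> block_map b) i"
    proof (cases "i \<in> I")
      case True
      have "e i 0 j \<otimes> (a \<oplus> b) \<otimes> e i k 0 =
          e i 0 j \<otimes> a \<otimes> e i k 0 \<oplus> e i 0 j \<otimes> b \<otimes> e i k 0" if "j < m i" "k < m i" for j k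
        using a b that e_closed[OF True] m_pos[OF True] by (simp add: l_distr r_distr)
      then show ?thesis
        using True by (auto simp: product_ring_def matrix_ring_def block_map_def)
    qed (simp add: block_map_def product_ring_def)
  qed
next
  show "block_map \<one> = \<one>\<^bsub>block_product\<^esub>"
  proof
    fix i
    show "block_map \<one> i = \<one>\<^bsub>block_product\<^esub> i"
    proof (cases "i \<in> I")
      case True
      have "e i 0 j \<otimes> \<one> \<otimes> e i k 0 = (if j = k then e i 0 0 else \<zero>)" if "j < m i" "k < m i" for j k
        using that True e_closed[OF True] m_pos[OF True] by (auto simp: e_mult_same e_mult_diff)
      then show ?thesis
        using True by (auto simp: product_ring_def matrix_ring_def block_map_def)
    qed (simp add: block_map_def product_ring_def)
  qed
qed

text \<open>Equal entries annihilate the components of the difference within a block, orthogonality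
  those between blocks. Separation on the right and then on the left leaves zero.\<close>

lemma block_map_inj:
  assumes "simple_blocks R I e"
  shows "inj_on block_map (carrier R)"
proof (rule inj_onI)
  fix a b assume a: "a \<in> carrier R" and b: "b \<in> carrier R" and eq: "block_map a = block_map b"
  have d: "a \<ominus> b \<in> carrier R" using a b by simp
  have "u p \<otimes> (a \<ominus> b) \<otimes> u q = \<zero>" if "p \<in> positions" "q \<in> positions" for p q
  proof -
    obtain i j where p: "p = (i, j)" "i \<in> I" "j < m i" using \<open>p \<in> positions\<close> by auto
    obtain i' k where q: "q = (i', k)" "i' \<in> I" "k < m i'" using \<open>q \<in> positions\<close> by auto
    show ?thesis
    proof (cases "i = i'")
      case True
      then have k: "k < m i" using q by simp
      note c = e_closed[OF p(2)] m_pos[OF p(2)]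
      have "e i 0 j \<otimes> a \<otimes> e i k 0 = e i 0 j \<otimes> b \<otimes> e i k 0"
        using block_map_apply[OF p(2,3) k] eq by metis
      then have "e i 0 j \<otimes> (a \<ominus> b) \<otimes> e i k 0 = \<zero>"
        using a b c p k by (simp add: a_minus_def l_distr r_distr l_minus r_minus r_neg)
      then have "e i j 0 \<otimes> (e i 0 j \<otimes> (a \<ominus> b) \<otimes> e i k 0) \<otimes> e i 0 k = \<zero>"
        using c p k by simp
      then have "e i j j \<otimes> (a \<ominus> b) \<otimes> e i k k = \<zero>"
        using c p k d by (simp add: m_assoc e_mult_same_assoc e_mult_same)
      then show ?thesis using p q True by simp
    next
      case False
      then show ?thesis using blocks_orth[OF assms p(2) q(2) False d p(3,3) q(3,3)] p q by simp
    qed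
  qed
  then have "u p \<otimes> (a \<ominus> b) = \<zero>" if "p \<in> positions" for p
    using right_separating[of "u p \<otimes> (a \<ominus> b)"] d u_closed[OF that] that by blast
  then have "a \<ominus> b = \<zero>" using left_separating[OF d] by blast
  then show "a = b" using a b by simp
qed

lemma block_map_surj:
  assumes y: "y \<in> carrier block_product"
  shows "\<exists>a\<in>carrier R. block_map a = y"
proof -
  \<comment> \<open>The preimage is assembled by sending each prescribed entry from the corner back
    to its place.\<close>
  define t where "t = (\<lambda>(i, j, k). e i j 0 \<otimes> y i (j, k) \<otimes> e i 0 k)"
  let ?S = "SIGMA i:I. {..<m i} \<times> {..<m i}"
  have yc: "y i (j, k) \<in> carrier R" "e i 0 0 \<otimes> y i (j, k) = y i (j, k)"
      "y i (j, k) \<otimes> e i 0 0 = y i (j, k)" if "i \<in> I" "j < m i" "k < m i" for i j k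
  proof -
    have "y i \<in> {..<m i} \<times> {..<m i} \<rightarrow>\<^sub>E carrier (corner_ring i)"
      using y that unfolding product_ring_def matrix_ring_def by (auto simp: PiE_def Pi_def)
    then have "y i (j, k) \<in> carrier (corner_ring i)" using that by auto
    then show "y i (j, k) \<in> carrier R" "e i 0 0 \<otimes> y i (j, k) = y i (j, k)"
      "y i (j, k) \<otimes> e i 0 0 = y i (j, k)" by auto
  qed
  have fin: "finite ?S" using finite_I by simp
  have tc: "t s \<in> carrier R" if "s \<in> ?S" for s
    using that yc e_closed m_pos by (auto simp: t_def)
  define a where "a = (\<Oplus>s\<in>?S. t s)"
  have a: "a \<in> carrier R" unfolding a_def using tc by (auto intro: finsum_closed)
  have entry: "e i 0 j \<otimes> a \<otimes> e i k 0 = y i (j, k)" if ijk: "i \<in> I" "j < m i" "k < m i" for i j k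
  proof -
    note c = e_closed[OF ijk(1)] m_pos[OF ijk(1)]
    have l: "e i 0 j \<in> carrier R" and r: "e i k 0 \<in> carrier R" using c ijk by auto
    have "e i 0 j \<otimes> a = (\<Oplus>s\<in>?S. e i 0 j \<otimes> t s)"
      unfolding a_def by (rule finsum_rdistr[OF fin l]) (use tc in blast)
    also have "\<dots> \<otimes> e i k 0 = (\<Oplus>s\<in>?S. e i 0 j \<otimes> t s \<otimes> e i k 0)"
      by (rule finsum_ldistr[OF fin r]) (use tc l in blast)
    \<comment> \<open>Matrix units with mismatched indices annihilate each other, so extracting an
      entry leaves the one matching summand.\<close>
    also have "\<dots> = (\<Oplus>s\<in>?S. if (i, j, k) = s then y i (j, k) else \<zero>)"
    proof (rule finsum_cong')
      fix s assume "s \<in> ?S"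
      then obtain i' j' k' where s: "s = (i', j', k')" "i' \<in> I" "j' < m i'" "k' < m i'" by auto
      note c' = e_closed[OF s(2)] m_pos[OF s(2)]
      have "e i 0 j \<otimes> t s \<otimes> e i k 0 =
          (e i 0 j \<otimes> e i' j' 0) \<otimes> y i' (j', k') \<otimes> (e i' 0 k' \<otimes> e i k 0)"
        using l r s c' yc by (simp add: t_def m_assoc)
      also have "\<dots> = (if (i, j, k) = s then y i (j, k) else \<zero>)"
      proof (cases "(i, j, k) = s")
        case True
        then show ?thesis using s c yc[OF ijk] ijk by (auto simp: e_mult_same)
      next
        case False
        then consider "i \<noteq> i' \<or> j \<noteq> j'" | "i' \<noteq> i \<or> k' \<noteq> k" using s by auto
        then show ?thesis
        proof cases
          case 1
          then have "e i 0 j \<otimes> e i' j' 0 = \<zero>" using e_mult_diff ijk s c(2) c'(2) by blast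
          then show ?thesis unfolding if_not_P[OF False] using c' s yc r by simp
        next
          case 2
          then have "e i' 0 k' \<otimes> e i k 0 = \<zero>" using e_mult_diff ijk s c(2) c'(2) by blast
          then show ?thesis unfolding if_not_P[OF False] using c' s yc l by simp
        qed
      qed
      finally show "e i 0 j \<otimes> t s \<otimes> e i k 0 = (if (i, j, k) = s then y i (j, k) else \<zero>)" .
    qed (use yc ijk in auto)
    also have "\<dots> = y i (j, k)"
      by (rule finsum_singleton[OF _ fin]) (use yc ijk in auto)
    finally show ?thesis .
  qed
  have "block_map a = y"
  proof (rule extensionalityI[of _ I])
    show "block_map a \<in> extensional I" by (simp add: block_map_def)
    show "y \<in> extensional I" using y by (simp add: product_ring_def PiE_def)
    fix i assume i: "i \<in> I"
    show "block_map a i = y i"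
    proof (rule extensionalityI[of _ "{..<m i} \<times> {..<m i}"])
      show "block_map a i \<in> extensional ({..<m i} \<times> {..<m i})" using i by (simp add: block_map_def)
      show "y i \<in> extensional ({..<m i} \<times> {..<m i})"
        using y i by (auto simp: product_ring_def matrix_ring_def PiE_def Pi_def)
      fix p assume "p \<in> {..<m i} \<times> {..<m i}"
      then show "block_map a i p = y i p" using entry i by (auto simp: block_map_def)
    qed
  qed
  then show ?thesis using a by blast
qed

lemma block_decomposition:
  assumes "simple_blocks R I e"
  shows "R \<simeq> block_product"
proof -
  have "block_map ` carrier R = carrier block_product"
    using block_map_surj ring_hom_closed[OF block_map_hom[OF assms]] by blast
  then have "block_map \<in> ring_iso R block_product"
    using block_map_hom[OF assms] block_map_inj[OF assms] by (simp add: ring_iso_def bij_betw_def)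
  then show ?thesis unfolding is_ring_iso_def by blast
qed

end

subsection \<open>Products of matrix rings over division rings\<close>

text \<open>The complement of the sum is killed by every \<open>u p\<close>, hence zero.
  Completeness of a system is thereby tested by separation, without evaluating a sum inside a
  product of matrix rings.\<close>

lemma (in ring) orthogonal_idempotents_sum:
  assumes "finite P" "\<And>p. p \<in> P \<Longrightarrow> u p \<in> carrier R" "\<And>p. p \<in> P \<Longrightarrow> u p \<otimes> u p = u p"
    and orth: "\<And>p q. \<lbrakk>p \<in> P; q \<in> P; p \<noteq> q\<rbrakk> \<Longrightarrow> u p \<otimes> u q = \<zero>"
    and sep: "\<And>x. \<lbrakk>x \<in> carrier R; \<And>p. p \<in> P \<Longrightarrow> x \<otimes> u p = \<zero>\<rbrakk> \<Longrightarrow> x = \<zero>"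
  shows "(\<Oplus>p\<in>P. u p) = \<one>"
proof -
  let ?s = "\<Oplus>p\<in>P. u p"
  have s: "?s \<in> carrier R" using assms(2) by (auto intro: finsum_closed)
  have "(\<one> \<ominus> ?s) \<otimes> u q = \<zero>" if q: "q \<in> P" for q
  proof -
    have "?s \<otimes> u q = (\<Oplus>p\<in>P. u p \<otimes> u q)"
      by (rule finsum_ldistr) (use assms(1,2) q in auto)
    also have "\<dots> = (\<Oplus>p\<in>P. if q = p then u q else \<zero>)"
      by (rule finsum_cong') (use assms(2,3) orth q in auto)
    also have "\<dots> = u q"
      by (rule finsum_singleton[OF q assms(1)]) (use assms(2) q in auto)
    finally show ?thesis using s assms(2)[OF q] by (simp add: a_minus_def l_distr l_minus r_neg)
  qed
  then have "\<one> \<ominus> ?s = \<zero>" using sep[of "\<one> \<ominus> ?s"] s by auto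
  then show ?thesis using s by simp
qed

section \<open>Entrywise calculus in products of matrix rings\<close>

locale division_blocks =
  fixes I :: "'i set" and m :: "'i \<Rightarrow> nat" and D :: "'i \<Rightarrow> 'd ring"
  assumes finite_I: "finite I" and m_pos: "i \<in> I \<Longrightarrow> 0 < m i"
    and division: "i \<in> I \<Longrightarrow> skew_field (D i)"
begin

abbreviation blocks :: "('i \<Rightarrow> nat \<times> nat \<Rightarrow> 'd) ring" where
  "blocks \<equiv> product_ring I (\<lambda>i. matrix_ring (m i) (D i))"

text \<open>The matrix unit of block \<open>i\<close> at (j, k), scaled by \<open>d\<close>.\<close>

definition single :: "'i \<Rightarrow> nat \<Rightarrow> nat \<Rightarrow> 'd \<Rightarrow> 'i \<Rightarrow> nat \<times> nat \<Rightarrow> 'd" where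
  "single i j k d = (\<lambda>i'\<in>I. \<lambda>(p, q)\<in>{..<m i'} \<times> {..<m i'}.
     if i' = i \<and> p = j \<and> q = k then d else \<zero>\<^bsub>D i'\<^esub>)"

lemma ring_D: "i \<in> I \<Longrightarrow> ring (D i)"
  using division skew_field.axioms(1) by blast

lemma entry_closed:
  "\<lbrakk>x \<in> carrier blocks; i \<in> I; p < m i; q < m i\<rbrakk> \<Longrightarrow> x i (p, q) \<in> carrier (D i)"
  by (auto simp: product_ring_def matrix_ring_def PiE_def Pi_def)

lemma single_closed: "\<lbrakk>i \<in> I; d \<in> carrier (D i)\<rbrakk> \<Longrightarrow> single i j k d \<in> carrier blocks"
  using ring_D by (auto simp: single_def product_ring_def matrix_ring_def ring.ring_simprules(2)
      split: if_splits)

lemma single_apply: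
  "\<lbrakk>i' \<in> I; p < m i'; q < m i'\<rbrakk> \<Longrightarrow>
     single i j k d i' (p, q) = (if i' = i \<and> p = j \<and> q = k then d else \<zero>\<^bsub>D i'\<^esub>)"
  by (simp add: single_def)

lemma zero_apply: "\<lbrakk>i \<in> I; p < m i; q < m i\<rbrakk> \<Longrightarrow> \<zero>\<^bsub>blocks\<^esub> i (p, q) = \<zero>\<^bsub>D i\<^esub>"
  by (simp add: product_ring_def matrix_ring_def)

lemma mult_apply:
  "\<lbrakk>i \<in> I; p < m i; q < m i\<rbrakk> \<Longrightarrow>
     (x \<otimes>\<^bsub>blocks\<^esub> y) i (p, q) = (\<Oplus>\<^bsub>D i\<^esub>r\<in>{..<m i}. x i (p, r) \<otimes>\<^bsub>D i\<^esub> y i (r, q))"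
  by (simp add: product_ring_def matrix_ring_def)

lemma zero_closed: "\<zero>\<^bsub>blocks\<^esub> \<in> carrier blocks"
  using ring_D by (auto simp: product_ring_def matrix_ring_def ring.ring_simprules(2))

lemma mult_closed:
  assumes "x \<in> carrier blocks" "y \<in> carrier blocks"
  shows "x \<otimes>\<^bsub>blocks\<^esub> y \<in> carrier blocks"
proof -
  have "(\<Oplus>\<^bsub>D i\<^esub>r\<in>{..<m i}. x i (p, r) \<otimes>\<^bsub>D i\<^esub> y i (r, q)) \<in> carrier (D i)"
    if i: "i \<in> I" "p < m i" "q < m i" for i p q
  proof -
    interpret D: ring "D i" by (rule ring_D[OF i(1)])
    show ?thesis using entry_closed assms i by (auto intro!: D.finsum_closed)
  qed
  then show ?thesis by (auto simp: product_ring_def matrix_ring_def split: if_splits)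
qed

lemma blocks_eqI:
  assumes "x \<in> carrier blocks" "y \<in> carrier blocks"
    and "\<And>i p q. \<lbrakk>i \<in> I; p < m i; q < m i\<rbrakk> \<Longrightarrow> x i (p, q) = y i (p, q)"
  shows "x = y"
proof (rule extensionalityI[of _ I])
  show "x \<in> extensional I" "y \<in> extensional I" using assms by (auto simp: product_ring_def PiE_def)
  fix i assume i: "i \<in> I"
  show "x i = y i"
  proof (rule extensionalityI[of _ "{..<m i} \<times> {..<m i}"])
    show "x i \<in> extensional ({..<m i} \<times> {..<m i})" "y i \<in> extensional ({..<m i} \<times> {..<m i})"
      using assms i by (auto simp: product_ring_def matrix_ring_def PiE_def Pi_def)
  qed (use assms(3) i in auto)
qed

lemma mult_single:
  assumes "x \<in> carrier blocks" "i \<in> I" "j < m i" "d \<in> carrier (D i)"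
    and i': "i' \<in> I" "p < m i'" "q < m i'"
  shows "(x \<otimes>\<^bsub>blocks\<^esub> single i j k d) i' (p, q) =
    (if i' = i \<and> q = k then x i' (p, j) \<otimes>\<^bsub>D i'\<^esub> d else \<zero>\<^bsub>D i'\<^esub>)"
proof -
  interpret D: ring "D i'" by (rule ring_D[OF i'(1)])
  interpret D': ring "D i" by (rule ring_D[OF assms(2)])
  have xc: "x i' (p, r) \<in> carrier (D i')" if "r < m i'" for r
    using entry_closed[OF assms(1) i'(1,2) that] .
  have "(x \<otimes>\<^bsub>blocks\<^esub> single i j k d) i' (p, q) =
      (\<Oplus>\<^bsub>D i'\<^esub>r\<in>{..<m i'}. x i' (p, r) \<otimes>\<^bsub>D i'\<^esub> single i j k d i' (r, q))"
    using mult_apply[OF i'] .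
  also have "\<dots> = (\<Oplus>\<^bsub>D i'\<^esub>r\<in>{..<m i'}. if j = r
      then (if i' = i \<and> q = k then x i' (p, r) \<otimes>\<^bsub>D i'\<^esub> d else \<zero>\<^bsub>D i'\<^esub>) else \<zero>\<^bsub>D i'\<^esub>)"
    by (rule D.finsum_cong') (use xc assms in \<open>auto simp: single_apply\<close>)
  also have "\<dots> = (if i' = i \<and> q = k then x i' (p, j) \<otimes>\<^bsub>D i'\<^esub> d else \<zero>\<^bsub>D i'\<^esub>)"
  proof (cases "i' = i \<and> q = k")
    case True
    show ?thesis
      unfolding if_P[OF True] by (rule D.finsum_singleton) (use True xc assms in auto)
  next
    case False
    show ?thesis unfolding if_not_P[OF False] by simp
  qed
  finally show ?thesis .
qed

lemma single_mult:
  assumes "x \<in> carrier blocks" "i \<in> I" "k < m i" "d \<in> carrier (D i)"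
    and i': "i' \<in> I" "p < m i'" "q < m i'"
  shows "(single i j k d \<otimes>\<^bsub>blocks\<^esub> x) i' (p, q) =
    (if i' = i \<and> p = j then d \<otimes>\<^bsub>D i'\<^esub> x i' (k, q) else \<zero>\<^bsub>D i'\<^esub>)"
proof -
  interpret D: ring "D i'" by (rule ring_D[OF i'(1)])
  interpret D': ring "D i" by (rule ring_D[OF assms(2)])
  have xc: "x i' (r, q) \<in> carrier (D i')" if "r < m i'" for r
    using entry_closed[OF assms(1) i'(1) that i'(3)] .
  have "(single i j k d \<otimes>\<^bsub>blocks\<^esub> x) i' (p, q) =
      (\<Oplus>\<^bsub>D i'\<^esub>r\<in>{..<m i'}. single i j k d i' (p, r) \<otimes>\<^bsub>D i'\<^esub> x i' (r, q))"
    using mult_apply[OF i'] .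
  also have "\<dots> = (\<Oplus>\<^bsub>D i'\<^esub>r\<in>{..<m i'}. if k = r
      then (if i' = i \<and> p = j then d \<otimes>\<^bsub>D i'\<^esub> x i' (r, q) else \<zero>\<^bsub>D i'\<^esub>) else \<zero>\<^bsub>D i'\<^esub>)"
    by (rule D.finsum_cong') (use xc assms in \<open>auto simp: single_apply\<close>)
  also have "\<dots> = (if i' = i \<and> p = j then d \<otimes>\<^bsub>D i'\<^esub> x i' (k, q) else \<zero>\<^bsub>D i'\<^esub>)"
  proof (cases "i' = i \<and> p = j")
    case True
    show ?thesis
      unfolding if_P[OF True] by (rule D.finsum_singleton) (use True xc assms in auto)
  next
    case False
    show ?thesis unfolding if_not_P[OF False] by simp
  qed
  finally show ?thesis .
qed

lemma single_mult_single_same: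
  assumes "i \<in> I" "j < m i" "k < m i" "l < m i" "c \<in> carrier (D i)" "d \<in> carrier (D i)"
  shows "single i j k c \<otimes>\<^bsub>blocks\<^esub> single i k l d = single i j l (c \<otimes>\<^bsub>D i\<^esub> d)"
proof -
  interpret D: ring "D i" by (rule ring_D[OF assms(1)])
  have cl: "single i j k c \<in> carrier blocks" "single i k l d \<in> carrier blocks"
    using assms single_closed by auto
  show ?thesis
  proof (rule blocks_eqI[OF mult_closed[OF cl]])
    show "single i j l (c \<otimes>\<^bsub>D i\<^esub> d) \<in> carrier blocks" using assms single_closed by simp
    fix i' p q assume "i' \<in> I" "p < m i'" "q < m i'"
    then show "(single i j k c \<otimes>\<^bsub>blocks\<^esub> single i k l d) i' (p, q) =
        single i j l (c \<otimes>\<^bsub>D i\<^esub> d) i' (p, q)"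
      using assms cl by (auto simp: mult_single single_apply)
  qed
qed

lemma single_mult_single_diff:
  assumes "i \<in> I" "j < m i" "k < m i" "c \<in> carrier (D i)"
    and "i' \<in> I" "j' < m i'" "k' < m i'" "d \<in> carrier (D i')" and "i \<noteq> i' \<or> k \<noteq> j'"
  shows "single i j k c \<otimes>\<^bsub>blocks\<^esub> single i' j' k' d = \<zero>\<^bsub>blocks\<^esub>"
proof -
  have cl: "single i j k c \<in> carrier blocks" "single i' j' k' d \<in> carrier blocks"
    using assms single_closed by auto
  show ?thesis
  proof (rule blocks_eqI[OF mult_closed[OF cl] zero_closed])
    fix i'' p q assume *: "i'' \<in> I" "p < m i''" "q < m i''"
    interpret D: ring "D i'" by (rule ring_D[OF assms(5)])
    show "(single i j k c \<otimes>\<^bsub>blocks\<^esub> single i' j' k' d) i'' (p, q) = \<zero>\<^bsub>blocks\<^esub> i'' (p, q)"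
      using assms cl * by (auto simp: mult_single single_apply zero_apply)
  qed
qed

text \<open>Compression to the corner sees only the entry (0, 0): the corner of block
  \<open>i\<close> is a copy of \<open>D i\<close>.\<close>

lemma sandwich_single:
  assumes "i \<in> I" "x \<in> carrier blocks" "c \<in> carrier (D i)" "d \<in> carrier (D i)"
  shows "single i 0 0 c \<otimes>\<^bsub>blocks\<^esub> x \<otimes>\<^bsub>blocks\<^esub> single i 0 0 d =
    single i 0 0 (c \<otimes>\<^bsub>D i\<^esub> x i (0, 0) \<otimes>\<^bsub>D i\<^esub> d)"
proof -
  interpret D: ring "D i" by (rule ring_D[OF assms(1)])
  note z = m_pos[OF assms(1)]
  have cl: "single i 0 0 c \<in> carrier blocks" "single i 0 0 d \<in> carrier blocks"
    using assms single_closed by auto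
  then have cx: "single i 0 0 c \<otimes>\<^bsub>blocks\<^esub> x \<in> carrier blocks" using mult_closed assms by blast
  have x0: "x i (0, 0) \<in> carrier (D i)" using entry_closed assms z by blast
  show ?thesis
  proof (rule blocks_eqI[OF mult_closed[OF cx cl(2)]])
    show "single i 0 0 (c \<otimes>\<^bsub>D i\<^esub> x i (0, 0) \<otimes>\<^bsub>D i\<^esub> d) \<in> carrier blocks"
      using assms x0 single_closed by simp
    fix i' p q assume *: "i' \<in> I" "p < m i'" "q < m i'"
    show "(single i 0 0 c \<otimes>\<^bsub>blocks\<^esub> x \<otimes>\<^bsub>blocks\<^esub> single i 0 0 d) i' (p, q) =
        single i 0 0 (c \<otimes>\<^bsub>D i\<^esub> x i (0, 0) \<otimes>\<^bsub>D i\<^esub> d) i' (p, q)"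
      using assms cx z * by (auto simp: mult_single single_mult single_apply)
  qed
qed

lemma sandwich_single_diff:
  assumes "i \<in> I" "i' \<in> I" "i \<noteq> i'" "x \<in> carrier blocks" "c \<in> carrier (D i)" "d \<in> carrier (D i')"
  shows "single i 0 0 c \<otimes>\<^bsub>blocks\<^esub> x \<otimes>\<^bsub>blocks\<^esub> single i' 0 0 d = \<zero>\<^bsub>blocks\<^esub>"
proof -
  note z = m_pos[OF assms(1)] m_pos[OF assms(2)]
  have cl: "single i 0 0 c \<in> carrier blocks" "single i' 0 0 d \<in> carrier blocks"
    using assms single_closed by auto
  then have cx: "single i 0 0 c \<otimes>\<^bsub>blocks\<^esub> x \<in> carrier blocks" using mult_closed assms by blast
  show ?thesis
  proof (rule blocks_eqI[OF mult_closed[OF cx cl(2)] zero_closed])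
    fix i'' p q assume *: "i'' \<in> I" "p < m i''" "q < m i''"
    interpret D: ring "D i'" by (rule ring_D[OF assms(2)])
    show "(single i 0 0 c \<otimes>\<^bsub>blocks\<^esub> x \<otimes>\<^bsub>blocks\<^esub> single i' 0 0 d) i'' (p, q) = \<zero>\<^bsub>blocks\<^esub> i'' (p, q)"
      using assms cx z * by (auto simp: mult_single single_mult zero_apply)
  qed
qed

lemma single_eq_zero:
  assumes "i \<in> I" "j < m i" "k < m i" "single i j k d = \<zero>\<^bsub>blocks\<^esub>"
  shows "d = \<zero>\<^bsub>D i\<^esub>"
  using single_apply[OF assms(1-3), of i j k d] zero_apply[OF assms(1-3)] assms(4) by simp

lemma single_right_separating:
  assumes "x \<in> carrier blocks"
    and "\<And>i j. \<lbrakk>i \<in> I; j < m i\<rbrakk> \<Longrightarrow> x \<otimes>\<^bsub>blocks\<^esub> single i j j \<one>\<^bsub>D i\<^esub> = \<zero>\<^bsub>blocks\<^esub>"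
  shows "x = \<zero>\<^bsub>blocks\<^esub>"
proof (rule blocks_eqI[OF assms(1) zero_closed])
  fix i p q assume *: "i \<in> I" "p < m i" "q < m i"
  interpret D: ring "D i" by (rule ring_D[OF *(1)])
  have "(x \<otimes>\<^bsub>blocks\<^esub> single i q q \<one>\<^bsub>D i\<^esub>) i (p, q) = x i (p, q)"
    using mult_single[OF assms(1) *(1,3) D.one_closed *] entry_closed[OF assms(1) *] by simp
  then show "x i (p, q) = \<zero>\<^bsub>blocks\<^esub> i (p, q)" using assms(2) * by simp
qed

text \<open>The standard matrix units are pulled back along the isomorphism. Ring laws are used in
  \<open>R\<close>, and \<open>blocks\<close> supplies entrywise products.\<close>

lemma matrix_units_of_iso:
  assumes "ring R" and iso: "R \<simeq> blocks"
  shows "\<exists>e. matrix_units R I m e \<and> simple_blocks R I e"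
proof -
  interpret R: ring R by fact
  obtain h where h: "h \<in> ring_iso R blocks" using iso unfolding is_ring_iso_def by blast
  then have hom: "h \<in> ring_hom R blocks" and bij: "bij_betw h (carrier R) (carrier blocks)"
    by (auto simp: ring_iso_def)
  note h_mult = ring_hom_mult[OF hom] and h_closed = ring_hom_closed[OF hom]
  have surj: "\<exists>x\<in>carrier R. h x = y" if "y \<in> carrier blocks" for y
  proof -
    have "y \<in> h ` carrier R" using bij that by (simp add: bij_betw_def)
    then show ?thesis by blast
  qed
  have inj: "x = y" if "x \<in> carrier R" "y \<in> carrier R" "h x = h y" for x y
    using bij that unfolding bij_betw_def by (meson inj_onD)
  \<comment> \<open>Zero is recognised in \<open>R\<close> as the only solution of z + z =
    z.\<close>
  have h_zero: "h \<zero>\<^bsub>R\<^esub> = \<zero>\<^bsub>blocks\<^esub>"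
  proof -
    obtain z where z: "z \<in> carrier R" "h z = \<zero>\<^bsub>blocks\<^esub>" using surj[OF zero_closed] by blast
    have "\<zero>\<^bsub>blocks\<^esub> \<oplus>\<^bsub>blocks\<^esub> \<zero>\<^bsub>blocks\<^esub> = \<zero>\<^bsub>blocks\<^esub>"
      using ring_D by (auto simp: product_ring_def matrix_ring_def fun_eq_iff restrict_def
          ring.ring_simprules(2,8))
    then have "h (z \<oplus>\<^bsub>R\<^esub> z) = h z" using ring_hom_add[OF hom z(1) z(1)] z by simp
    then have "z \<oplus>\<^bsub>R\<^esub> z = z" using inj z by simp
    then have "z = \<zero>\<^bsub>R\<^esub>" using z by simp
    then show ?thesis using z by simp
  qed
  define e where "e i j k = inv_into (carrier R) h (single i j k \<one>\<^bsub>D i\<^esub>)" for i j k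
  have one: "\<one>\<^bsub>D i\<^esub> \<in> carrier (D i)" "\<one>\<^bsub>D i\<^esub> \<noteq> \<zero>\<^bsub>D i\<^esub>"
      "\<one>\<^bsub>D i\<^esub> \<otimes>\<^bsub>D i\<^esub> \<one>\<^bsub>D i\<^esub> = \<one>\<^bsub>D i\<^esub>" if "i \<in> I" for i
  proof -
    interpret D: skew_field "D i" using division that .
    show "\<one>\<^bsub>D i\<^esub> \<in> carrier (D i)" "\<one>\<^bsub>D i\<^esub> \<otimes>\<^bsub>D i\<^esub> \<one>\<^bsub>D i\<^esub> = \<one>\<^bsub>D i\<^esub>" by simp_all
    show "\<one>\<^bsub>D i\<^esub> \<noteq> \<zero>\<^bsub>D i\<^esub>" using D.Units_one_closed D.skew_field_Units by blast
  qed
  have img: "h ` carrier R = carrier blocks" using bij by (simp add: bij_betw_def)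
  have e: "e i j k \<in> carrier R" "h (e i j k) = single i j k \<one>\<^bsub>D i\<^esub>"
    if "i \<in> I" for i j k
  proof -
    have "single i j k \<one>\<^bsub>D i\<^esub> \<in> h ` carrier R" using single_closed that one(1) img by blast
    then show "e i j k \<in> carrier R" "h (e i j k) = single i j k \<one>\<^bsub>D i\<^esub>"
      unfolding e_def by (auto intro: inv_into_into f_inv_into_f)
  qed
  have same: "e i j k \<otimes>\<^bsub>R\<^esub> e i k l = e i j l"
    if "i \<in> I" "j < m i" "k < m i" "l < m i" for i j k l
    by (rule inj) (use that e one single_mult_single_same in \<open>simp_all add: h_mult\<close>)
  have diff: "e i j k \<otimes>\<^bsub>R\<^esub> e i' j' k' = \<zero>\<^bsub>R\<^esub>"
    if "i \<in> I" "j < m i" "k < m i" "i' \<in> I" "j' < m i'" "k' < m i'" "i \<noteq> i' \<or> k \<noteq> j'"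
    for i j k i' j' k'
  proof (rule inj)
    show "h (e i j k \<otimes>\<^bsub>R\<^esub> e i' j' k') = h \<zero>\<^bsub>R\<^esub>"
      using single_mult_single_diff[OF that(1-3) one(1) that(4-6) one(1) that(7)] that e
      by (simp add: h_mult h_zero)
  qed (use that e in simp_all)
  have "matrix_units R I m e"
  proof
    let ?P = "SIGMA i:I. {..<m i}"
    show "(\<Oplus>\<^bsub>R\<^esub>p\<in>?P. e (fst p) (snd p) (snd p)) = \<one>\<^bsub>R\<^esub>"
    proof (rule R.orthogonal_idempotents_sum)
      show "finite ?P" using finite_I by simp
      fix p assume p: "p \<in> ?P"
      then have p': "fst p \<in> I" "snd p < m (fst p)" by auto
      show "e (fst p) (snd p) (snd p) \<in> carrier R" using e p' by blast
      show "e (fst p) (snd p) (snd p) \<otimes>\<^bsub>R\<^esub> e (fst p) (snd p) (snd p) = e (fst p) (snd p) (snd p)"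
        using same p' by blast
      fix q assume q: "q \<in> ?P" "p \<noteq> q"
      then have "fst q \<in> I" "snd q < m (fst q)" "fst p \<noteq> fst q \<or> snd p \<noteq> snd q"
        by (auto simp: prod_eq_iff)
      then show "e (fst p) (snd p) (snd p) \<otimes>\<^bsub>R\<^esub> e (fst q) (snd q) (snd q) = \<zero>\<^bsub>R\<^esub>"
        using diff p' by blast
    next
      fix x assume x: "x \<in> carrier R"
        and ann: "\<And>p. p \<in> ?P \<Longrightarrow> x \<otimes>\<^bsub>R\<^esub> e (fst p) (snd p) (snd p) = \<zero>\<^bsub>R\<^esub>"
      have "h x \<otimes>\<^bsub>blocks\<^esub> single i j j \<one>\<^bsub>D i\<^esub> = \<zero>\<^bsub>blocks\<^esub>" if "i \<in> I" "j < m i" for i j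
      proof -
        have "x \<otimes>\<^bsub>R\<^esub> e i j j = \<zero>\<^bsub>R\<^esub>" using ann[of "(i, j)"] that by simp
        then have "h (x \<otimes>\<^bsub>R\<^esub> e i j j) = \<zero>\<^bsub>blocks\<^esub>" using h_zero by simp
        then show ?thesis using h_mult[OF x] e that by simp
      qed
      then have "h x = h \<zero>\<^bsub>R\<^esub>" using single_right_separating[OF h_closed[OF x]] h_zero by simp
      then show "x = \<zero>\<^bsub>R\<^esub>" using inj x by blast
    qed
    show "e i 0 0 \<noteq> \<zero>\<^bsub>R\<^esub>" if "i \<in> I" for i
    proof
      assume "e i 0 0 = \<zero>\<^bsub>R\<^esub>"
      then have "single i 0 0 \<one>\<^bsub>D i\<^esub> = \<zero>\<^bsub>blocks\<^esub>" using e(2)[OF that] h_zero by metis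
      then show False using single_eq_zero m_pos one that by blast
    qed
  qed (use finite_I m_pos e same diff in blast)+
  moreover have "simple_blocks R I e"
    unfolding simple_blocks_def
  proof (intro conjI ballI impI)
    fix i i' x assume *: "i \<in> I" "i' \<in> I" "x \<in> carrier R" "i \<noteq> i'"
    show "e i 0 0 \<otimes>\<^bsub>R\<^esub> x \<otimes>\<^bsub>R\<^esub> e i' 0 0 = \<zero>\<^bsub>R\<^esub>"
    proof (rule inj)
      show "h (e i 0 0 \<otimes>\<^bsub>R\<^esub> x \<otimes>\<^bsub>R\<^esub> e i' 0 0) = h \<zero>\<^bsub>R\<^esub>"
        using sandwich_single_diff[OF *(1,2,4) h_closed[OF *(3)]] * e one
        by (simp add: h_mult h_zero)
    qed (use * e in simp_all)
  next
    fix i x assume *: "i \<in> I" "x \<in> carrier R"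
      and nz: "e i 0 0 \<otimes>\<^bsub>R\<^esub> x \<otimes>\<^bsub>R\<^esub> e i 0 0 \<noteq> \<zero>\<^bsub>R\<^esub>"
    interpret D: skew_field "D i" using division *(1) .
    let ?d = "h x i (0, 0)"
    have d: "?d \<in> carrier (D i)" using entry_closed[OF h_closed[OF *(2)] *(1)] m_pos[OF *(1)] by blast
    have hx: "h (e i 0 0 \<otimes>\<^bsub>R\<^esub> x \<otimes>\<^bsub>R\<^esub> e i 0 0) = single i 0 0 ?d"
      using sandwich_single[OF *(1) h_closed[OF *(2)]] * e one d by (simp add: h_mult)
    have "?d \<noteq> \<zero>\<^bsub>D i\<^esub>"
    proof
      assume "?d = \<zero>\<^bsub>D i\<^esub>"
      then have "single i 0 0 ?d = \<zero>\<^bsub>blocks\<^esub>"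
        using single_closed[OF *(1)] d zero_closed
        by (intro blocks_eqI) (auto simp: single_apply zero_apply)
      then have "h (e i 0 0 \<otimes>\<^bsub>R\<^esub> x \<otimes>\<^bsub>R\<^esub> e i 0 0) = h \<zero>\<^bsub>R\<^esub>" using hx h_zero by simp
      then have "e i 0 0 \<otimes>\<^bsub>R\<^esub> x \<otimes>\<^bsub>R\<^esub> e i 0 0 = \<zero>\<^bsub>R\<^esub>" by (rule inj[rotated 2]) (use * e in simp_all)
      then show False using nz by simp
    qed
    then have "?d \<in> Units (D i)" using d D.skew_field_Units by blast
    then obtain c where c: "c \<in> carrier (D i)" "c \<otimes>\<^bsub>D i\<^esub> ?d = \<one>\<^bsub>D i\<^esub>" unfolding Units_def by blast
    \<comment> \<open>The inverse in the corner is the inverse of the entry (0, 0) in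
      \<open>D i\<close>, placed back at that entry.\<close>
    obtain y where y: "y \<in> carrier R" "h y = single i 0 0 c" using surj single_closed[OF *(1) c(1)] by blast
    have "y \<otimes>\<^bsub>R\<^esub> (e i 0 0 \<otimes>\<^bsub>R\<^esub> x \<otimes>\<^bsub>R\<^esub> e i 0 0) = e i 0 0"
    proof (rule inj)
      have "h (y \<otimes>\<^bsub>R\<^esub> (e i 0 0 \<otimes>\<^bsub>R\<^esub> x \<otimes>\<^bsub>R\<^esub> e i 0 0)) =
          h y \<otimes>\<^bsub>blocks\<^esub> h (e i 0 0 \<otimes>\<^bsub>R\<^esub> x \<otimes>\<^bsub>R\<^esub> e i 0 0)"
        using y * e by (intro h_mult) simp_all
      also have "\<dots> = single i 0 0 (c \<otimes>\<^bsub>D i\<^esub> ?d)"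
        unfolding hx y(2) using single_mult_single_same[OF *(1) _ _ _ c(1) d] m_pos[OF *(1)] by blast
      also have "\<dots> = h (e i 0 0)" using c e * by simp
      finally show "h (y \<otimes>\<^bsub>R\<^esub> (e i 0 0 \<otimes>\<^bsub>R\<^esub> x \<otimes>\<^bsub>R\<^esub> e i 0 0)) = h (e i 0 0)" .
    qed (use y * e in simp_all)
    then show "\<exists>y\<in>carrier R. y \<otimes>\<^bsub>R\<^esub> (e i 0 0 \<otimes>\<^bsub>R\<^esub> x \<otimes>\<^bsub>R\<^esub> e i 0 0) = e i 0 0" using y by blast
  qed
  ultimately show ?thesis by blast
qed

end

theorem corollary2p4:
  fixes R :: "('a, 'r) ring_scheme" and A :: "('a, 's) ring_scheme" and \<sigma> :: "'a \<Rightarrow> 'a"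
  assumes "semisimple_ring R"
    and "\<sigma> \<in> ring_hom R R" and "inj_on \<sigma> (carrier R)"
    and "jordan_extension R \<sigma> A"
  shows "semisimple_ring A \<and>
    (\<forall>(n :: nat) (m :: nat \<Rightarrow> nat) (D :: nat \<Rightarrow> 'd ring).
       (\<forall>i \<in> {1..n}. m i \<ge> 1 \<and> skew_field (D i)) \<and>
       R \<simeq> product_ring {1..n} (\<lambda>i. matrix_ring (m i) (D i)) \<longrightarrow>
       (\<exists>K :: nat \<Rightarrow> 'a ring. (\<forall>i \<in> {1..n}. skew_field (K i)) \<and>
          A \<simeq> product_ring {1..n} (\<lambda>i. matrix_ring (m i) (K i))))"
proof -
  have R: "ring R" using assms(1) by (simp add: semisimple_ring_def)
  obtain T where "absorbing_extension R A T"
    using absorbing_extension_of_jordan[OF R assms(2,4)] by blast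
  then interpret absorbing_extension R A T .
  show ?thesis
  proof (intro conjI allI impI)
    show "semisimple_ring A" by (rule semisimple_extension[OF assms(1)])
    fix n :: nat and m :: "nat \<Rightarrow> nat" and D :: "nat \<Rightarrow> 'd ring"
    assume *: "(\<forall>i \<in> {1..n}. m i \<ge> 1 \<and> skew_field (D i)) \<and>
       R \<simeq> product_ring {1..n} (\<lambda>i. matrix_ring (m i) (D i))"
    interpret division_blocks "{1..n}" m D
      by (rule division_blocks.intro) (use * in force)+
    obtain e where e: "matrix_units R {1..n} m e" "simple_blocks R {1..n} e"
      using matrix_units_of_iso[OF R] * by blast
    interpret E: matrix_units A "{1..n}" m e by (rule matrix_units_extension[OF e(1)])
    have "simple_blocks A {1..n} e" by (rule simple_blocks_extension[OF e])
    \<comment> \<open>The division rings are the corners of \<open>A\<close> at matrix units chosen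
      in \<open>R\<close>; using the same units over \<open>A\<close> keeps the sizes
      \<open>m i\<close>.\<close>
    then show "\<exists>K :: nat \<Rightarrow> 'a ring. (\<forall>i \<in> {1..n}. skew_field (K i)) \<and>
          A \<simeq> product_ring {1..n} (\<lambda>i. matrix_ring (m i) (K i))"
      using E.skew_field_corner_ring E.block_decomposition by (intro exI[of _ E.corner_ring]) blast
  qed
qed

end
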